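(* Let $\theta$ be a proper, primitive, aperiodic substitution, with associated minimal substitution system $(X^\theta,T)$. Let $p:X^\theta\to\mathbb{Z}^+$ be a bounded function such that $S(x)=T^{p(x)}(x)$ defines a homeomorphism $S:X^\theta\to X^\theta$, and suppose that $S$ is minimal. Then $(X^\theta,S)$ is a substitution system, i.e. it is topologically conjugate to the subshift $(X^\tau,T_\tau)$ generated by some primitive substitution $\tau$, where $T_\tau$ is the shift map on $X^\tau$.
   Context: Let $\mathcal{A}$ be a finite alphabet and $\mathcal{A}^*$ the set of finite words over $\mathcal{A}$. A substitution is a function $\theta:\mathcal{A}\to\mathcal{A}^*$, extended to $\mathcal{A}^*\to\mathcal{A}^*$ by concatenation, so that iterates $\theta^k$ are defined. $X^\theta\subset\mathcal{A}^{\mathbb{Z}}$ is the set of all $x$ such that for all $i<j$ the word $x_ix_{i+1}\cdots x_j$ is a subword of $\theta^k(a)$ for some $k\ge0$ and $a\in\mathcal{A}$; $T$ is the shift map $T(x)_k=x_{k+1}$ restricted to $X^\theta$. $\theta$ is primitive if (1) for any $a,b\in\mathcal{A}$ there is $k\ge0$ such that $b$ occurs in $\theta^k(a)$, and (2) $\lim_{k\to\infty}|\theta^k(a)|=\infty$ for every $a\in\mathcal{A}$ (where $|w|$ is word length). $\theta$ is proper if there exist $\ell,r\in\mathcal{A}$ and $k\ge0$ such that for all $a\in\mathcal{A}$ the word $\theta^k(a)$ begins with $\ell$ and ends with $r$. $\theta$ is aperiodic if $X^\theta$ contains no periodic points of the shift. If $\theta$ is proper, primitive and aperiodic then $(X^\theta,T)$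 is a minimal Cantor system (a homeomorphism of a Cantor space with all orbits dense). *)

theory Defs
  imports "HOL-Analysis.Analysis" "HOL-Library.Sublist"
begin

text \<open>
  Alphabets are finite sets \<open>A\<close> rather than finite types, so that one can quantify
  existentially over alphabets inside a formula.  Values of a substitution outside its
  alphabet are irrelevant.
\<close>

definition substitution :: "'a set \<Rightarrow> ('a \<Rightarrow> 'a list) \<Rightarrow> bool" where
  "substitution A \<theta> \<longleftrightarrow> finite A \<and> \<theta> \<in> A \<rightarrow> lists A"

definition subst_word :: "('a \<Rightarrow> 'a list) \<Rightarrow> 'a list \<Rightarrow> 'a list" where
  "subst_word \<theta> w = concat (map \<theta> w)"

definition subst_iter :: "('a \<Rightarrow> 'a list) \<Rightarrow> nat \<Rightarrow> 'a \<Rightarrow> 'a list" where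
  "subst_iter \<theta> k a = (subst_word \<theta> ^^ k) [a]"

definition primitive_subst :: "'a set \<Rightarrow> ('a \<Rightarrow> 'a list) \<Rightarrow> bool" where
  "primitive_subst A \<theta> \<longleftrightarrow>
     (\<forall>a\<in>A. \<forall>b\<in>A. \<exists>k. b \<in> set (subst_iter \<theta> k a)) \<and>
     (\<forall>a\<in>A. filterlim (\<lambda>k. length (subst_iter \<theta> k a)) at_top sequentially)"

definition proper_subst :: "'a set \<Rightarrow> ('a \<Rightarrow> 'a list) \<Rightarrow> bool" where
  "proper_subst A \<theta> \<longleftrightarrow>
     (\<exists>l\<in>A. \<exists>r\<in>A. \<exists>k. \<forall>a\<in>A.
        prefix [l] (subst_iter \<theta> k a) \<and> suffix [r] (subst_iter \<theta> k a))"

definition subst_points :: "'a set \<Rightarrow> ('a \<Rightarrow> 'a list) \<Rightarrow> (int \<Rightarrow> 'a) set" where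
  "subst_points A \<theta> =
     {x. range x \<subseteq> A \<and>
         (\<forall>i j. i < j \<longrightarrow> (\<exists>k. \<exists>a\<in>A. sublist (map x [i..j]) (subst_iter \<theta> k a)))}"

definition subst_space :: "'a set \<Rightarrow> ('a \<Rightarrow> 'a list) \<Rightarrow> (int \<Rightarrow> 'a) topology" where
  "subst_space A \<theta> =
     subtopology (product_topology (\<lambda>_. discrete_topology A) UNIV) (subst_points A \<theta>)"

lemma topspace_subst_space [simp]: "topspace (subst_space A \<theta>) = subst_points A \<theta>"
  by (auto simp: subst_space_def subst_points_def)

definition shift :: "(int \<Rightarrow> 'a) \<Rightarrow> int \<Rightarrow> 'a" where
  "shift x = (\<lambda>k. x (k + 1))"

definition aperiodic_subst :: "'a set \<Rightarrow> ('a \<Rightarrow> 'a list) \<Rightarrow> bool" where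
  "aperiodic_subst A \<theta> \<longleftrightarrow> \<not> (\<exists>x\<in>subst_points A \<theta>. \<exists>n>0. (shift ^^ n) x = x)"

definition speedup :: "((int \<Rightarrow> 'a) \<Rightarrow> nat) \<Rightarrow> (int \<Rightarrow> 'a) \<Rightarrow> int \<Rightarrow> 'a" where
  "speedup p x = (shift ^^ p x) x"

text \<open>
  The two-sided orbit of \<open>x\<close> under a bijection \<open>S\<close> of the set \<open>Y\<close>; the inverse
  is that of the restriction of \<open>S\<close> to \<open>Y\<close>.
\<close>

definition full_orbit :: "'b set \<Rightarrow> ('b \<Rightarrow> 'b) \<Rightarrow> 'b \<Rightarrow> 'b set" where
  "full_orbit Y S x = {(S ^^ n) x | n. True} \<union> {(inv_into Y S ^^ n) x | n. True}"

definition minimal_homeo :: "'b topology \<Rightarrow> ('b \<Rightarrow> 'b) \<Rightarrow> bool" where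
  "minimal_homeo X S \<longleftrightarrow>
     homeomorphic_map X X S \<and>
     (\<forall>x\<in>topspace X. X closure_of (full_orbit (topspace X) S x) = topspace X)"

definition conjugate_systems ::
  "'b topology \<Rightarrow> ('b \<Rightarrow> 'b) \<Rightarrow> 'c topology \<Rightarrow> ('c \<Rightarrow> 'c) \<Rightarrow> bool" where
  "conjugate_systems X S Y R \<longleftrightarrow>
     (\<exists>h. homeomorphic_map X Y h \<and> (\<forall>x\<in>topspace X. h (S x) = R (h x)))"

end

theory Submission
  imports Defs
begin

text \<open>
  Write \<open>T\<close> for the shift on \<open>X = subst_points A \<theta>\<close> and \<open>S = T^p\<close> for the speedup.  After passing
  to a power of \<open>\<theta>\<close>, which does not change \<open>X\<close>, every image \<open>\<theta> a\<close> contains all letters, starts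
  with one letter \<open>l\<close> and ends with one letter \<open>r\<close>.  Let \<open>om\<close> be the right-infinite fixed point that
  starts with \<open>l\<close>.

  For each level \<open>n\<close> call the occurrences of \<open>\<theta>\<^sup>n(l)\<close> the cuts of level \<open>n\<close>.  They are visible in a
  bounded window of a point, so they divide \<open>X\<close> into finitely many towers with clopen floors: a
  floor records the return word between two consecutive cuts and an offset in it.  Because \<open>p\<close> is
  bounded and locally constant, the course of an \<open>S\<close>-orbit through a return word depends only on the
  word and on the place of entry.

  The heart of the proof is a pigeonhole argument (\<open>similar_levels\<close>).  Cuts that are much closer
  than the length of \<open>\<theta>\<^sup>n(l)\<close> would make \<open>om\<close> periodic, so the number of cuts of level \<open>n\<close> in a block
  \<open>\<theta>\<^sup>n(a)\<close> is bounded independently of \<open>n\<close>.  Moreover a window of \<open>om\<close> of length independent of \<open>n\<close>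
  determines, for each \<open>n\<close>, how many cuts lie in the image of its first letter, which return words
  follow them and how orbits pass through these words.  Seen in terms of such windows, a level
  carries one of finitely many data.  Hence there are levels \<open>n < n'\<close>, with \<open>n'\<close> as large as
  desired, such that equality of the \<open>i\<close>-th and the \<open>j\<close>-th return word of level \<open>n\<close> implies the same
  for level \<open>n'\<close>, and such that the orbit enters the \<open>i\<close>-th return word of both levels at the same
  offset.

  Cuts of level \<open>n'\<close> are cuts of level \<open>n\<close>, so every return word of level \<open>n'\<close> is a product of return
  words of level \<open>n\<close>, and \<open>i\<close>-th word of level \<open>n\<close> \<open>\<mapsto>\<close> factorization of the \<open>i\<close>-th word of level
  \<open>n'\<close> is a well-defined substitution.  Spreading the factors over the points at which the orbit
  visits the \<open>i\<close>-th word turns it into a substitution \<open>\<tau>\<close> on floors that fixes the sequence \<open>\<zeta>\<close> of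
  floors visited by one forward \<open>S\<close>-orbit (\<open>self_similar_orbit\<close>).  Minimality of \<open>S\<close> makes \<open>\<zeta>\<close>
  uniformly recurrent.  Therefore \<open>\<tau>\<close> is primitive, \<open>X\<^sup>\<tau>\<close> consists of the two-sided sequences all of
  whose words occur in \<open>\<zeta>\<close> (locale \<open>self_similar\<close>), and the \<open>S\<close>-itinerary through the floors is the
  required conjugacy (\<open>self_similar_coding_conjugacy\<close>).
\<close>


section \<open>Words and iterates of a substitution\<close>

lemma subst_word_append: "subst_word \<theta> (u @ v) = subst_word \<theta> u @ subst_word \<theta> v"
  by (simp add: subst_word_def)

lemma iter_word_append:
  "(subst_word \<theta> ^^ n) (u @ v) = (subst_word \<theta> ^^ n) u @ (subst_word \<theta> ^^ n) v"
  by (induction n) (simp_all add: subst_word_append)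

lemma iter_word_Nil: "(subst_word \<theta> ^^ n) [] = []"
  by (induction n) (simp_all add: subst_word_def)

lemma iter_word_add:
  "(subst_word \<theta> ^^ (m + n)) w = (subst_word \<theta> ^^ m) ((subst_word \<theta> ^^ n) w)"
  by (simp add: funpow_add)

lemma iter_word_concat: "(subst_word \<theta> ^^ n) w = concat (map (subst_iter \<theta> n) w)"
proof (induction w)
  case Nil show ?case by (simp add: iter_word_Nil)
next
  case (Cons a w)
  have "(subst_word \<theta> ^^ n) ([a] @ w) = subst_iter \<theta> n a @ (subst_word \<theta> ^^ n) w"
    unfolding iter_word_append by (simp add: subst_iter_def)
  then show ?case using Cons by simp
qed

lemma subst_iter_in_lists:
  assumes "substitution A \<theta>" "w \<in> lists A"
  shows "(subst_word \<theta> ^^ n) w \<in> lists A"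
  using assms(2)
proof (induction n)
  case (Suc n)
  have "subst_word \<theta> u \<in> lists A" if "u \<in> lists A" for u
    using that assms(1) by (induction u) (auto simp: subst_word_def substitution_def Pi_def)
  moreover have "(subst_word \<theta> ^^ n) w \<in> lists A" using Suc by simp
  ultimately show ?case by simp
qed simp

lemma sublist_iter_word:
  "sublist u w \<Longrightarrow> sublist ((subst_word \<theta> ^^ n) u) ((subst_word \<theta> ^^ n) w)"
  unfolding sublist_def by (metis iter_word_append)

lemma shift_pow: "(shift ^^ n) x = (\<lambda>i. x (i + int n))"
  by (induction n) (auto simp: shift_def algebra_simps)

lemma sublist_nth_offset:
  assumes "sublist u w"
  shows "\<exists>c. c + length u \<le> length w \<and> (\<forall>i<length u. u ! i = w ! (c + i))"
proof -
  obtain a b where "w = a @ u @ b" using assms by (auto simp: sublist_def)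
  then show ?thesis by (intro exI[of _ "length a"]) (auto simp: nth_append)
qed

lemma sublist_of_nth_offset:
  assumes "c + length u \<le> length w" "\<forall>i<length u. u ! i = w ! (c + i)"
  shows "sublist u w"
proof -
  have "u = take (length u) (drop c w)" using assms by (intro nth_equalityI) auto
  then show ?thesis by (metis sublist_drop sublist_order.order_trans sublist_take)
qed

section \<open>Positions in strictly increasing sequences\<close>

text \<open>
  For strictly increasing \<open>f\<close> this is the number of values of \<open>f\<close> below \<open>x\<close>.  It is used for two
  sequences: the cuts of a level and the times of an orbit.
\<close>

definition idx :: "(nat \<Rightarrow> nat) \<Rightarrow> nat \<Rightarrow> nat" where
  "idx f x = (LEAST i. x \<le> f i)"

lemma idx_ge: assumes "strict_mono f" shows "x \<le> f (idx f x)"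
  unfolding idx_def using strict_mono_imp_increasing[OF assms, of x] by (rule LeastI)

lemma idx_less: "i < idx f x \<Longrightarrow> f i < x"
  unfolding idx_def using not_less_Least not_le by blast

lemma idx_le: "x \<le> f i \<Longrightarrow> idx f x \<le> i"
  unfolding idx_def by (rule Least_le)

lemma less_idx_iff: assumes "strict_mono f" shows "i < idx f x \<longleftrightarrow> f i < x"
proof
  assume "f i < x"
  then have "f i < f (idx f x)" using idx_ge[OF assms, of x] by simp
  then show "i < idx f x" using assms by (simp add: strict_mono_less)
qed (rule idx_less)

lemma idx_le_iff: "strict_mono f \<Longrightarrow> idx f x \<le> i \<longleftrightarrow> x \<le> f i"
  using less_idx_iff[of f i x] by linarith

lemma idx_of_value: assumes "strict_mono f" shows "idx f (f i) = i"
proof (rule le_antisym)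
  show "idx f (f i) \<le> i" by (simp add: idx_le_iff[OF assms])
  show "i \<le> idx f (f i)" using idx_ge[OF assms, of "f i"] strict_mono_less_eq[OF assms] by blast
qed

lemma idx_mono: "strict_mono f \<Longrightarrow> x \<le> y \<Longrightarrow> idx f x \<le> idx f y"
  using idx_ge[of f y] by (simp add: idx_le_iff)

lemma interval_exists:
  assumes "strict_mono f" "f 0 \<le> (x::nat)"
  shows "\<exists>i. f i \<le> x \<and> x < f (Suc i)"
proof -
  have "0 < idx f (Suc x)" using less_idx_iff[OF assms(1)] assms(2) by simp
  then obtain i where i: "idx f (Suc x) = Suc i" using gr0_implies_Suc by blast
  have "f i < Suc x" using less_idx_iff[OF assms(1), of i "Suc x"] i by simp
  moreover have "Suc x \<le> f (Suc i)" using idx_ge[OF assms(1), of "Suc x"] i by simp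
  ultimately have "f i \<le> x \<and> x < f (Suc i)" by linarith
  then show ?thesis by blast
qed

lemma interval_unique:
  assumes "strict_mono f" "f i \<le> (x::nat)" "x < f (Suc i)" "f j \<le> x" "x < f (Suc j)"
  shows "i = j"
proof -
  have "f i < f (Suc j)" "f j < f (Suc i)" using assms by linarith+
  then have "i < Suc j" "j < Suc i" using strict_mono_less[OF assms(1)] by blast+
  then show ?thesis by simp
qed

lemma filter_range_interval:
  assumes "strict_mono f" "x \<le> y"
  shows "map f [idx f x..<idx f y] = filter (\<lambda>z. z \<in> range f) [x..<y]"
proof (rule sorted_distinct_set_unique)
  have "sorted_wrt (<) (map f [idx f x..<idx f y])"
    by (rule sorted_wrt_map_mono) (use assms(1) in \<open>auto simp: strict_mono_less\<close>)
  then show "sorted (map f [idx f x..<idx f y])" "distinct (map f [idx f x..<idx f y])"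
    using strict_sorted_iff by blast+
  show "sorted (filter (\<lambda>z. z \<in> range f) [x..<y])" "distinct (filter (\<lambda>z. z \<in> range f) [x..<y])"
    by (simp_all add: sorted_wrt_filter)
  show "set (map f [idx f x..<idx f y]) = set (filter (\<lambda>z. z \<in> range f) [x..<y])"
  proof (intro set_eqI)
    fix z
    show "z \<in> set (map f [idx f x..<idx f y]) \<longleftrightarrow> z \<in> set (filter (\<lambda>z. z \<in> range f) [x..<y])"
      using less_idx_iff[OF assms(1)] idx_le_iff[OF assms(1)] by auto
  qed
qed

text \<open>
  A set that looks the same from \<open>a\<close> and from \<open>a'\<close> meets corresponding intervals in translates of one
  list.  Comparisons between two places of \<open>om\<close> reduce to this.
\<close>

lemma shifted_interval_list:
  assumes "\<And>m. m \<in> {u..<u'} \<Longrightarrow> (a + m \<in> S \<longleftrightarrow> a' + m \<in> S)"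
  shows "filter (\<lambda>z. z \<in> S) [a + u..<a + u'] = map (\<lambda>m. a + m) (filter (\<lambda>m. a + m \<in> S) [u..<u'])"
    and "filter (\<lambda>z. z \<in> S) [a' + u..<a' + u'] = map (\<lambda>m. a' + m) (filter (\<lambda>m. a + m \<in> S) [u..<u'])"
proof -
  have e: "[b + u..<b + u'] = map (\<lambda>m. b + m) [u..<u']" for b
    by (intro nth_equalityI) auto
  show "filter (\<lambda>z. z \<in> S) [a + u..<a + u'] = map (\<lambda>m. a + m) (filter (\<lambda>m. a + m \<in> S) [u..<u'])"
    by (simp add: e filter_map o_def)
  have "filter (\<lambda>m. a' + m \<in> S) [u..<u'] = filter (\<lambda>m. a + m \<in> S) [u..<u']"
    using assms by (intro filter_cong) auto
  then show "filter (\<lambda>z. z \<in> S) [a' + u..<a' + u'] = map (\<lambda>m. a' + m) (filter (\<lambda>m. a + m \<in> S) [u..<u'])"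
    by (simp add: e filter_map o_def)
qed

lemma idx_diff_shift:
  assumes "strict_mono f" "u \<le> u'"
    and "\<And>m. m \<in> {u..<u'} \<Longrightarrow> (a + m \<in> range f \<longleftrightarrow> a' + m \<in> range f)"
  shows "idx f (a + u') - idx f (a + u) = idx f (a' + u') - idx f (a' + u)"
proof -
  have "length (map f [idx f (a + u)..<idx f (a + u')]) = length (map f [idx f (a' + u)..<idx f (a' + u')])"
    using assms shifted_interval_list[OF assms(3)] by (simp add: filter_range_interval)
  then show ?thesis by simp
qed

text \<open>
  If the values of \<open>f\<close> look the same from \<open>a\<close> and from \<open>a'\<close> over a distance \<open>N\<close>, then the \<open>q\<close>-th value
  after \<open>a\<close> and the \<open>q\<close>-th value after \<open>a'\<close> have the same offset: counting values up to an offset gives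
  the same number on both sides.
\<close>

lemma value_shift:
  assumes f: "strict_mono f"
    and eq: "\<And>m. m \<le> N \<Longrightarrow> (a + m \<in> range f \<longleftrightarrow> a' + m \<in> range f)"
    and le: "f (idx f a + q) \<le> a + N"
  shows "\<exists>m\<le>N. f (idx f a + q) = a + m \<and> f (idx f a' + q) = a' + m"
proof -
  have "a \<le> f (idx f a + q)" using idx_le_iff[OF f, of a "idx f a + q"] by simp
  then obtain m where m: "f (idx f a + q) = a + m" using le_Suc_ex by blast
  then have mN: "m \<le> N" using le by simp
  have "a + m \<in> range f" using m by (metis rangeI)
  then have "a' + m \<in> range f" using eq mN by blast
  then obtain j where j: "a' + m = f j" by blast
  have "idx f (a + m) - idx f (a + 0) = idx f (a' + m) - idx f (a' + 0)"
    using mN by (intro idx_diff_shift[OF f]) (auto simp: eq)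
  moreover have "idx f (a + m) = idx f a + q" using m idx_of_value[OF f] by metis
  moreover have "idx f (a' + m) \<ge> idx f a'" using idx_mono[OF f] by simp
  ultimately have "idx f (a' + m) = idx f a' + q" by simp
  then have "f (idx f a' + q) = a' + m" using j idx_of_value[OF f] by metis
  then show ?thesis using m mN by blast
qed

text \<open>
  Division by \<open>\<mu>\<close> is injective on a set with gaps larger than \<open>\<mu>\<close>.
\<close>

lemma card_separated_le:
  fixes F :: "nat set"
  assumes "\<mu> > 0" "F \<subseteq> {a..<a + C * \<mu>}"
    and "\<And>c c'. c \<in> F \<Longrightarrow> c' \<in> F \<Longrightarrow> c < c' \<Longrightarrow> c + \<mu> < c'"
  shows "card F \<le> C"
proof -
  have "inj_on (\<lambda>c. (c - a) div \<mu>) F"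
  proof (rule linorder_inj_onI)
    fix c c' assume c: "c < c'" "c \<in> F" "c' \<in> F"
    then have "c + \<mu> < c'" "a \<le> c" using assms by auto
    then have "(c - a) + \<mu> \<le> c' - a" by simp
    then have "(c - a + \<mu>) div \<mu> \<le> (c' - a) div \<mu>" by (rule div_le_mono)
    then show "(c - a) div \<mu> \<noteq> (c' - a) div \<mu>" using assms(1) by simp
  qed auto
  moreover have "(\<lambda>c. (c - a) div \<mu>) ` F \<subseteq> {..<C}"
  proof safe
    fix c assume "c \<in> F"
    then have "a \<le> c" "c < a + C * \<mu>" using assms(2) by auto
    then have "c - a < C * \<mu>" by linarith
    then show "(c - a) div \<mu> < C" by (simp add: less_mult_imp_div_less)
  qed
  ultimately have "card F \<le> card {..<C}" by (intro card_inj_on_le) auto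
  then show ?thesis by simp
qed

section \<open>Positive substitutions and their right-infinite fixed point\<close>

text \<open>
  These assumptions hold for a power of every proper primitive substitution.
\<close>

locale positive_subst =
  fixes A :: "'a set" and \<theta> :: "'a \<Rightarrow> 'a list" and l r :: 'a
  assumes finite_A: "finite A" and l_in: "l \<in> A" and r_in: "r \<in> A"
    and set_image: "a \<in> A \<Longrightarrow> set (\<theta> a) = A"
    and length_image: "a \<in> A \<Longrightarrow> 2 \<le> length (\<theta> a)"
    and image_starts: "a \<in> A \<Longrightarrow> \<exists>u. \<theta> a = l # u"
    and image_ends: "a \<in> A \<Longrightarrow> \<exists>u. \<theta> a = u @ [r]"
begin

abbreviation it :: "nat \<Rightarrow> 'a list \<Rightarrow> 'a list" where
  "it n w \<equiv> (subst_word \<theta> ^^ n) w"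

lemma is_substitution: "substitution A \<theta>"
  using finite_A set_image by (auto simp: substitution_def)

lemma set_it: "set w \<subseteq> A \<Longrightarrow> set (it n w) \<subseteq> A"
  using subst_iter_in_lists[OF is_substitution, of w n] by auto

lemma length_subst_word: "set w \<subseteq> A \<Longrightarrow> 2 * length w \<le> length (subst_word \<theta> w)"
proof (induction w)
  case (Cons a w)
  then show ?case using length_image[of a] by (auto simp: subst_word_def)
qed (simp add: subst_word_def)

lemma length_it: "set w \<subseteq> A \<Longrightarrow> 2 ^ n * length w \<le> length (it n w)"
proof (induction n)
  case (Suc n)
  have "2 * length (it n w) \<le> length (subst_word \<theta> (it n w))"
    using length_subst_word set_it Suc.prems by blast
  then show ?case using Suc by simp
qed simp

lemma length_it_letter_gt: "a \<in> A \<Longrightarrow> n < length (it n [a])"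
  using length_it[of "[a]" n] less_le_trans[OF less_exp[of n]] by simp

lemma it_starts: "\<exists>u. it n [l] = l # u"
proof (induction n)
  case (Suc n)
  then obtain u where "it n [l] = l # u" by blast
  then have "it (Suc n) [l] = \<theta> l @ subst_word \<theta> u" by (simp add: subst_word_def)
  then show ?case using image_starts[OF l_in] by auto
qed simp

lemma it_ends: "\<exists>u. it n [r] = u @ [r]"
proof (induction n)
  case (Suc n)
  then obtain u where "it n [r] = u @ [r]" by blast
  then have "it (Suc n) [r] = subst_word \<theta> u @ \<theta> r" by (simp add: subst_word_def)
  then show ?case using image_ends[OF r_in] by auto
qed simp

lemma it_l_extends: "\<exists>u. it (n + m) [l] = it n [l] @ u"
proof -
  obtain u where "it m [l] = l # u" using it_starts by blast
  then have "it (n + m) [l] = it n ([l] @ u)" by (simp add: iter_word_add)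
  then show ?thesis unfolding iter_word_append by blast
qed

lemma it_r_extends: "\<exists>u. it (n + m) [r] = u @ it n [r]"
proof -
  obtain u where "it m [r] = u @ [r]" using it_ends by blast
  then have "it (n + m) [r] = it n (u @ [r])" by (simp add: iter_word_add)
  then show ?thesis unfolding iter_word_append by blast
qed

text \<open>
  The limit of the words \<open>\<theta>\<^sup>n(l)\<close>, each of which is a prefix of the next; \<open>\<theta>\<^sup>i(l)\<close> is long enough
  to have an entry at \<open>i\<close>.
\<close>

definition om :: "nat \<Rightarrow> 'a" where "om i = it i [l] ! i"

lemma it_l_nth: assumes "i < length (it m [l])" shows "it m [l] ! i = om i"
proof -
  obtain u where "it (m + i) [l] = it m [l] @ u" using it_l_extends by blast
  then have 1: "it (m + i) [l] ! i = it m [l] ! i" using assms by (simp add: nth_append)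
  obtain u' where "it (i + m) [l] = it i [l] @ u'" using it_l_extends by blast
  then have "it (m + i) [l] ! i = it i [l] ! i" using length_it_letter_gt[OF l_in, of i]
    by (simp add: nth_append add.commute)
  then show ?thesis using 1 by (simp add: om_def)
qed

lemma it_l_eq: "it m [l] = map om [0..<length (it m [l])]"
  by (intro nth_equalityI) (auto simp: it_l_nth)

lemma om_in: "om i \<in> A"
proof -
  have "om i \<in> set (it i [l])" unfolding om_def using length_it_letter_gt[OF l_in] by simp
  then show ?thesis using set_it[of "[l]" i] l_in by auto
qed

text \<open>
  The sequence \<open>om\<close> is the concatenation of the blocks \<open>\<theta>\<^sup>n(om k)\<close>; block \<open>k\<close> starts at \<open>pos n k\<close>.
\<close>

definition pos :: "nat \<Rightarrow> nat \<Rightarrow> nat" where "pos n k = length (it n (map om [0..<k]))"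

lemma it_om_prefix: "it n (map om [0..<k]) = map om [0..<pos n k]"
proof -
  have k: "k \<le> length (it k [l])" using length_it_letter_gt[OF l_in, of k] by simp
  then obtain j where j: "length (it k [l]) = k + j" using le_Suc_ex by blast
  have "[0..<k + j] = [0..<k] @ [k..<k + j]" using upt_add_eq_append[of 0 k j] by simp
  then have "it k [l] = map om [0..<k] @ map om [k..<k+j]" using it_l_eq[of k] j by simp
  then have e: "it (n + k) [l] = it n (map om [0..<k]) @ it n (map om [k..<k+j])"
    by (simp add: iter_word_add iter_word_append)
  show ?thesis
  proof (intro nth_equalityI)
    fix i assume i: "i < length (it n (map om [0..<k]))"
    then have "it n (map om [0..<k]) ! i = it (n + k) [l] ! i" unfolding e by (simp add: nth_append)
    also have "\<dots> = om i" using i by (intro it_l_nth) (simp add: e)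
    finally show "it n (map om [0..<k]) ! i = map om [0..<pos n k] ! i" using i by (simp add: pos_def)
  qed (simp add: pos_def)
qed

lemma pos_0 [simp]: "pos n 0 = 0" by (simp add: pos_def iter_word_Nil)

lemma pos_add: "pos n (k + j) = pos n k + length (it n (map om [k..<k + j]))"
proof -
  have "[0..<k + j] = [0..<k] @ [k..<k + j]" using upt_add_eq_append[of 0 k j] by simp
  then show ?thesis by (simp add: pos_def iter_word_append)
qed

lemma pos_Suc: "pos n (Suc k) = pos n k + length (it n [om k])"
  using pos_add[of n k 1] by simp

lemma om_segment: "it n (map om [k..<k + j]) = map om [pos n k..<pos n (k + j)]"
proof -
  have "[0..<k + j] = [0..<k] @ [k..<k + j]" using upt_add_eq_append[of 0 k j] by simp
  then have "it n (map om [0..<k + j]) = it n (map om [0..<k]) @ it n (map om [k..<k + j])"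
    by (simp add: iter_word_append)
  moreover have "[0..<pos n (k + j)] = [0..<pos n k] @ [pos n k..<pos n (k + j)]"
    using upt_add_eq_append[of 0 "pos n k" "pos n (k+j) - pos n k"] pos_add[of n k j] by simp
  ultimately show ?thesis by (simp add: it_om_prefix)
qed

lemma strict_mono_pos: "strict_mono (pos n)"
proof (rule strict_monoI_Suc)
  fix k show "pos n k < pos n (Suc k)"
    using length_it_letter_gt[OF om_in, of n k] unfolding pos_Suc by linarith
qed

lemma om_pos_nth:
  assumes "i < length (it n [om k])" shows "om (pos n k + i) = it n [om k] ! i"
proof -
  have "it n [om k] = map om [pos n k..<pos n k + length (it n [om k])]"
    using om_segment[of n k 1] by (simp add: pos_Suc)
  from arg_cong[OF this, of "\<lambda>w. w ! i"] show ?thesis using assms by simp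
qed

lemma pos_mono: "j \<le> k \<Longrightarrow> pos n j \<le> pos n k"
  using strict_mono_pos strict_mono_less_eq by blast

text \<open>
  Equal windows of \<open>om\<close> have equal images under \<open>\<theta>\<^sup>n\<close>, and these images are again pieces of \<open>om\<close>.
\<close>

lemma om_window:
  assumes "map om [k..<k + j] = map om [k'..<k' + j]"
  shows "pos n (k + j) - pos n k = pos n (k' + j) - pos n k'"
    and "i < pos n (k + j) - pos n k \<Longrightarrow> om (pos n k + i) = om (pos n k' + i)"
proof -
  have e: "map om [pos n k..<pos n (k + j)] = map om [pos n k'..<pos n (k' + j)]"
    using assms om_segment by metis
  then show l: "pos n (k + j) - pos n k = pos n (k' + j) - pos n k'"
    by (metis length_map length_upt)
  assume "i < pos n (k + j) - pos n k"
  then show "om (pos n k + i) = om (pos n k' + i)"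
    using arg_cong[OF e, of "\<lambda>w. w ! i"] l by simp
qed

text \<open>
  Each letter occurs in \<open>\<theta>(l)\<close>, so \<open>\<theta>\<^sup>k(a)\<close> is part of the prefix \<open>\<theta>\<^sup>k\<^sup>+\<^sup>1(l)\<close> of \<open>om\<close>.
\<close>

lemma language_occurs_in_om:
  assumes "sublist u (subst_iter \<theta> k a)" "a \<in> A"
  shows "\<exists>c. \<forall>i<length u. u ! i = om (c + i)"
proof -
  have "a \<in> set (it 1 [l])" using set_image[OF l_in] assms(2) by (simp add: subst_word_def)
  then have "sublist [a] (it 1 [l])"
    by (metis append_Cons append_Nil in_set_conv_decomp sublist_appendI)
  then have "sublist (it k [a]) (it (k + 1) [l])" by (metis iter_word_add sublist_iter_word)
  then have "sublist u (it (k + 1) [l])" using assms(1)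
    by (metis subst_iter_def sublist_order.order_trans)
  then obtain c where c: "c + length u \<le> length (it (k + 1) [l])"
    "\<forall>i<length u. u ! i = it (k + 1) [l] ! (c + i)"
    using sublist_nth_offset by blast
  show ?thesis
  proof (intro exI allI impI)
    fix i assume "i < length u"
    then show "u ! i = om (c + i)" using c it_l_nth[of "c + i" "k + 1"] by auto
  qed
qed

lemma length_it_pred_le: assumes "n \<ge> 1" "a \<in> A" "b \<in> A"
  shows "length (it (n - 1) [a]) \<le> length (it n [b])"
proof -
  have "a \<in> set (\<theta> b)" using set_image assms by auto
  then obtain u v where "\<theta> b = u @ [a] @ v" by (metis append_Cons append_Nil in_set_conv_decomp)
  moreover have "it n [b] = it (n - 1) (\<theta> b)"
    using assms(1) funpow_Suc_right[of "n - 1" "subst_word \<theta>"]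
    by (simp add: subst_word_def)
  ultimately have "it n [b] = it (n - 1) u @ it (n - 1) [a] @ it (n - 1) v"
    by (metis iter_word_append)
  then show ?thesis by simp
qed

lemma length_it_le: assumes "\<And>a. a \<in> set w \<Longrightarrow> length (it n [a]) \<le> b"
  shows "length (it n w) \<le> length w * b"
  using assms
proof (induction w)
  case (Cons a w)
  have "length (it n ([a] @ w)) = length (it n [a]) + length (it n w)" unfolding iter_word_append by simp
  moreover have "length (it n [a]) \<le> b" "length (it n w) \<le> length w * b" using Cons by auto
  ultimately show ?case by simp
qed (simp add: iter_word_Nil)

end

section \<open>Cuts of level n\<close>

context positive_subst
begin

text \<open>
  A cut of level \<open>n\<close> is the starting point of an occurrence of \<open>\<theta>\<^sup>n(l)\<close>, which is the prefix of \<open>om\<close>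
  of length \<open>vlen n\<close>.  A cut need not be the start of a block \<open>\<theta>\<^sup>n(om k)\<close>, but being a cut is a
  condition on a window of \<open>om\<close>.
\<close>

definition vlen :: "nat \<Rightarrow> nat" where "vlen n = length (it n [l])"

definition cut :: "nat \<Rightarrow> nat \<Rightarrow> bool" where
  "cut n c \<longleftrightarrow> (\<forall>i<vlen n. om (c + i) = om i)"

definition cs :: "nat \<Rightarrow> nat \<Rightarrow> nat" where "cs n = enumerate {c. cut n c}"

lemma cut_0: "cut n 0" by (simp add: cut_def)

lemma vlen_gt: "n < vlen n" unfolding vlen_def using length_it_letter_gt[OF l_in] .

lemma vlen_mono: "n \<le> n' \<Longrightarrow> vlen n \<le> vlen n'"
  using it_l_extends[of n "n' - n"] by (auto simp: vlen_def)

lemma cut_mono: "n \<le> n' \<Longrightarrow> cut n' c \<Longrightarrow> cut n c"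
  using vlen_mono[of n n'] by (auto simp: cut_def)

lemma pos_vlen: "pos m (vlen d) = vlen (m + d)"
  unfolding pos_def vlen_def it_l_eq[symmetric] by (simp add: iter_word_add)

lemma cut_pos: assumes "om k = l" shows "cut n (pos n k)"
  unfolding cut_def
proof (intro allI impI)
  fix i assume i: "i < vlen n"
  then have "om (pos n k + i) = it n [l] ! i" using om_pos_nth[of i n k] assms by (simp add: vlen_def)
  then show "om (pos n k + i) = om i" using i it_l_nth[of i n] by (simp add: vlen_def)
qed

definition lmax :: nat where "lmax = Max ((\<lambda>a. length (\<theta> a)) ` A)"

lemma length_image_le: "a \<in> A \<Longrightarrow> length (\<theta> a) \<le> lmax"
  unfolding lmax_def using finite_A by simp

lemma lmax_pos: "lmax > 0"
  using length_image_le[OF l_in] length_image[OF l_in] by linarith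

text \<open>
  \<open>om\<close> is a product of words \<open>\<theta> a\<close>, which start with \<open>l\<close> and have length at most \<open>lmax\<close>.
\<close>

lemma l_recurs: "\<exists>k'. k < k' \<and> k' \<le> k + lmax \<and> om k' = l"
proof -
  obtain j where j: "pos 1 j \<le> k" "k < pos 1 (Suc j)"
    using interval_exists[OF strict_mono_pos, of 1 k] by auto
  have "om (pos 1 (Suc j)) = l"
    using om_pos_nth[of 0 1 "Suc j"] image_starts[OF om_in[of "Suc j"]]
    by (auto simp: subst_word_def)
  moreover have "pos 1 (Suc j) \<le> k + lmax"
    using j length_image_le[OF om_in[of j]] pos_Suc[of 1 j] by (simp add: subst_word_def)
  ultimately show ?thesis using j by blast
qed

lemma cut_in_window: "\<exists>c. cut n c \<and> pos n (Suc k) \<le> c \<and> c \<le> pos n (k + lmax)"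
proof -
  obtain k' where "k < k'" "k' \<le> k + lmax" "om k' = l" using l_recurs by blast
  then show ?thesis using cut_pos pos_mono by (metis Suc_leI)
qed

lemma infinite_cuts: "infinite {c. cut n c}"
  unfolding infinite_nat_iff_unbounded_le
proof
  fix m
  obtain c where "cut n c" "pos n (Suc m) \<le> c" using cut_in_window by blast
  moreover have "Suc m \<le> pos n (Suc m)" using strict_mono_pos strict_mono_imp_increasing by blast
  ultimately show "\<exists>k\<ge>m. k \<in> {c. cut n c}" by (intro exI[of _ c]) simp
qed

lemma strict_mono_cs: "strict_mono (cs n)"
  unfolding cs_def using strict_mono_enumerate infinite_cuts by blast

lemma range_cs: "range (cs n) = {c. cut n c}"
  unfolding cs_def using range_enumerate infinite_cuts by blast

lemma cut_cs: "cut n (cs n i)" using range_cs by blast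

lemma cs_0 [simp]: "cs n 0 = 0"
proof -
  obtain i where "cs n i = 0" using cut_0 range_cs[of n] by (metis imageE mem_Collect_eq)
  then show ?thesis using strict_mono_less_eq[OF strict_mono_cs[of n], of 0 i] by simp
qed

lemma cs_Suc_le: "cut n c \<Longrightarrow> cs n i < c \<Longrightarrow> cs n (Suc i) \<le> c"
proof -
  assume "cut n c" "cs n i < c"
  then obtain j where j: "c = cs n j" using range_cs[of n] by (metis imageE mem_Collect_eq)
  then have "i < j" using \<open>cs n i < c\<close> strict_mono_less[OF strict_mono_cs] by blast
  then show ?thesis using j strict_mono_less_eq[OF strict_mono_cs] by (metis Suc_leI)
qed

text \<open>
  Among \<open>lmax\<close> consecutive letters there is an \<open>l\<close>, whose image under \<open>\<theta>\<^sup>n\<close> has length \<open>vlen n\<close>.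
\<close>

lemma vlen_le_window: "pos n j + vlen n \<le> pos n (j + lmax)" if "0 < j"
proof -
  obtain k' where k': "j - 1 < k'" "k' \<le> j - 1 + lmax" "om k' = l" using l_recurs by blast
  have "pos n k' + vlen n = pos n (Suc k')" using k' by (simp add: pos_Suc vlen_def)
  moreover have "pos n j \<le> pos n k'" "pos n (Suc k') \<le> pos n (j + lmax)"
    using k' that by (auto intro!: pos_mono)
  ultimately show ?thesis by linarith
qed

definition bmax :: "nat \<Rightarrow> nat" where "bmax n = Max ((\<lambda>a. length (it n [a])) ` A)"
definition bmin :: "nat \<Rightarrow> nat" where "bmin n = Min ((\<lambda>a. length (it n [a])) ` A)"

lemma bmax: "a \<in> A \<Longrightarrow> length (it n [a]) \<le> bmax n"
  unfolding bmax_def using finite_A by simp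

lemma bmin: "a \<in> A \<Longrightarrow> bmin n \<le> length (it n [a])"
  unfolding bmin_def using finite_A by simp

lemma bmin_attained: "\<exists>a\<in>A. bmin n = length (it n [a])"
proof -
  have "bmin n \<in> (\<lambda>a. length (it n [a])) ` A"
    unfolding bmin_def using finite_A l_in by (intro Min_in) auto
  then show ?thesis by blast
qed

lemma bmin_gt: "n < bmin n" using bmin_attained[of n] length_it_letter_gt by auto

lemma cs_gap_le: "cs n (Suc i) \<le> cs n i + (lmax + 1) * bmax n"
proof -
  obtain k where k: "pos n k \<le> cs n i" "cs n i < pos n (Suc k)"
    using interval_exists[OF strict_mono_pos, of n "cs n i"] by auto
  obtain c where c: "cut n c" "pos n (Suc k) \<le> c" "c \<le> pos n (k + lmax)"
    using cut_in_window by blast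
  then have "cs n (Suc i) \<le> pos n (k + lmax)" using cs_Suc_le[of n c i] k by linarith
  also have "\<dots> \<le> pos n k + lmax * bmax n"
  proof -
    have "length (it n (map om [k..<k + lmax])) \<le> length (map om [k..<k + lmax]) * bmax n"
      by (rule length_it_le) (auto intro: bmax om_in)
    then show ?thesis by (simp add: pos_add)
  qed
  finally show ?thesis using k by simp
qed

text \<open>
  All blocks of neighbouring levels have comparable lengths: \<open>\<theta>\<^sup>m(b)\<close> contains \<open>\<theta>\<^sup>m\<^sup>-\<^sup>1(a)\<close> for all
  letters \<open>a\<close> and \<open>b\<close>, and \<open>\<theta>\<^sup>n(a)\<close> is a product of boundedly many blocks \<open>\<theta>\<^sup>n\<^sup>-\<^sup>d\<^sup>-\<^sup>1(b)\<close>.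
\<close>

lemma bmax_le_bmin: "\<exists>C. \<forall>n>d. bmax n \<le> C * bmin (n - d)"
proof (intro exI allI impI)
  fix n assume n: "n > d"
  have "length (it n [a]) \<le> bmax (d + 1) * bmin (n - d)" if a: "a \<in> A" for a
  proof -
    have "it n [a] = it (n - d - 1) (it (d + 1) [a])"
      using n by (simp only: iter_word_add[symmetric]) simp
    moreover have "length (it (n - d - 1) [b]) \<le> bmin (n - d)" if "b \<in> A" for b
      using bmin_attained[of "n - d"] length_it_pred_le[of "n - d" b] that n by fastforce
    moreover have "set (it (d + 1) [a]) \<subseteq> A" by (rule set_it) (simp add: a)
    ultimately have "length (it n [a]) \<le> length (it (d + 1) [a]) * bmin (n - d)"
      using length_it_le[of "it (d + 1) [a]" "n - d - 1" "bmin (n - d)"] by auto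
    also have "\<dots> \<le> bmax (d + 1) * bmin (n - d)" using bmax[OF a] by (rule mult_le_mono1)
    finally show ?thesis .
  qed
  then show "bmax n \<le> bmax (d + 1) * bmin (n - d)"
    unfolding bmax_def[of n] using finite_A l_in by (subst Max_le_iff) auto
qed

end

locale aperiodic_positive_subst = positive_subst +
  assumes om_aperiodic: "\<delta> > 0 \<Longrightarrow> \<exists>k. om k \<noteq> om (k + \<delta>)"
begin

text \<open>
  Only finitely many two-letter words occur in \<open>om\<close>, so a long enough prefix contains all of them.
\<close>

lemma two_letter_words: "\<exists>d. \<forall>k. \<exists>j. Suc j < vlen d \<and> om j = om k \<and> om (Suc j) = om (Suc k)"
proof -
  let ?W = "range (\<lambda>k. (om k, om (Suc k)))"
  have "?W \<subseteq> A \<times> A" using om_in by auto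
  then have fin: "finite ?W" using finite_A finite_subset by blast
  define J where "J w = (SOME k. (om k, om (Suc k)) = w)" for w
  have J: "(om (J w), om (Suc (J w))) = w" if "w \<in> ?W" for w
    unfolding J_def using that by (metis (mono_tags, lifting) imageE someI_ex)
  have le: "J w \<le> Max (J ` ?W)" if "w \<in> ?W" for w using fin that by simp
  let ?d = "Suc (Max (J ` ?W))"
  show ?thesis
  proof (intro exI allI)
    fix k
    let ?w = "(om k, om (Suc k))"
    have "J ?w < ?d" using le[of ?w] by auto
    moreover have "?d < vlen ?d" by (rule vlen_gt)
    ultimately show "Suc (J ?w) < vlen ?d \<and> om (J ?w) = om k \<and> om (Suc (J ?w)) = om (Suc k)"
      using J[of ?w] by auto
  qed
qed

text \<open>
  Two cuts of level \<open>n\<close> at distance \<open>\<delta>\<close> give \<open>\<theta>\<^sup>n(l)\<close> the period \<open>\<delta>\<close>.  For suitable \<open>d\<close>, the word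
  \<open>\<theta>\<^sup>d(l)\<close> contains all two-letter words of \<open>om\<close>, so \<open>\<theta>\<^sup>n(l)\<close> contains \<open>\<theta>\<^sup>n\<^sup>-\<^sup>d\<close> of all of them.  If
  \<open>\<delta>\<close> were at most the length of a shortest block of level \<open>n - d\<close>, any two positions of \<open>om\<close> at
  distance \<open>\<delta>\<close> would lie in the image of a two-letter word, and \<open>om\<close> would be periodic.
\<close>

lemma cut_gap_gt: "\<exists>d. \<forall>n\<ge>d. \<forall>c c'. cut n c \<longrightarrow> cut n c' \<longrightarrow> c < c' \<longrightarrow> c + bmin (n - d) < c'"
proof -
  obtain d where d: "\<And>k. \<exists>j. Suc j < vlen d \<and> om j = om k \<and> om (Suc j) = om (Suc k)"
    using two_letter_words by blast
  show ?thesis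
  proof (intro exI allI impI)
    fix n c c' assume n: "d \<le> n" and c: "cut n c" "cut n c'" "c < c'"
    define m where "m = n - d"
    define \<delta> where "\<delta> = c' - c"
    show "c + bmin (n - d) < c'"
    proof (rule ccontr)
      assume "\<not> ?thesis"
      then have \<delta>: "\<delta> > 0" "\<delta> \<le> bmin m" using c(3) by (auto simp: \<delta>_def m_def)
      have per: "om i = om (i + \<delta>)" if "i + \<delta> < vlen n" for i
      proof -
        have "c + (i + \<delta>) = c' + i" using c(3) by (simp add: \<delta>_def)
        then show ?thesis using c(1,2) that unfolding cut_def by (metis add_lessD1)
      qed
      have "om k = om (k + \<delta>)" for k
      proof -
        obtain j where j: "pos m j \<le> k" "k < pos m (Suc j)"
          using interval_exists[OF strict_mono_pos, of m k] by auto
        obtain j' where j': "Suc j' < vlen d" "om j' = om j" "om (Suc j') = om (Suc j)" using d by blast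
        define i where "i = k - pos m j"
        have w: "map om [j..<j + 2] = map om [j'..<j' + 2]" using j' by (simp add: numeral_2_eq_2)
        have "\<delta> \<le> length (it m [om (Suc j)])" using \<delta>(2) bmin[OF om_in] by (meson le_trans)
        then have i\<delta>: "i + \<delta> < pos m (j + 2) - pos m j"
          using j pos_Suc[of m "Suc j"] by (simp add: i_def)
        have "pos m (j' + 2) \<le> pos m (vlen d)" using j' by (intro pos_mono) simp
        then have le: "pos m (j' + 2) \<le> vlen n" using n by (simp add: pos_vlen m_def)
        have "om k = om (pos m j + i)" "om (k + \<delta>) = om (pos m j + (i + \<delta>))" using j by (simp_all add: i_def)
        moreover have "om (pos m j + i) = om (pos m j' + i)" using om_window(2)[OF w, of i m] i\<delta> by simp
        moreover have "om (pos m j + (i + \<delta>)) = om (pos m j' + (i + \<delta>))" using om_window(2)[OF w] i\<delta> by simp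
        moreover have "om (pos m j' + i) = om (pos m j' + i + \<delta>)"
          using i\<delta> le om_window(1)[OF w, of m] by (intro per) linarith
        ultimately show ?thesis by (simp add: add.assoc)
      qed
      then show False using om_aperiodic[OF \<delta>(1)] by blast
    qed
  qed
qed

text \<open>
  The gaps between cuts of level \<open>n\<close> exceed \<open>bmin (n - d)\<close>, while blocks of level \<open>n\<close> have at most a
  constant multiple of this length.
\<close>

lemma cut_counts: 
  "\<exists>d K. (\<forall>n\<ge>d. \<forall>c c'. cut n c \<longrightarrow> cut n c' \<longrightarrow> c < c' \<longrightarrow> c + bmin (n - d) < c') \<and>
     (\<forall>n>d. \<forall>k. card {c. cut n c \<and> pos n k \<le> c \<and> c < pos n (Suc k)} \<le> K)"
proof -
  obtain d where d: "\<forall>n\<ge>d. \<forall>c c'. cut n c \<longrightarrow> cut n c' \<longrightarrow> c < c' \<longrightarrow> c + bmin (n - d) < c'"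
    using cut_gap_gt by blast
  obtain C where C: "\<forall>n>d. bmax n \<le> C * bmin (n - d)" using bmax_le_bmin by blast
  have "card {c. cut n c \<and> pos n k \<le> c \<and> c < pos n (Suc k)} \<le> C" if n: "n > d" for n k
  proof (rule card_separated_le)
    show "0 < bmin (n - d)" using bmin_gt[of "n - d"] by simp
    have "pos n (Suc k) \<le> pos n k + C * bmin (n - d)"
      using pos_Suc[of n k] bmax[OF om_in, of n k] C[rule_format, OF n] by linarith
    then show "{c. cut n c \<and> pos n k \<le> c \<and> c < pos n (Suc k)} \<subseteq> {pos n k..<pos n k + C * bmin (n - d)}"
      by auto
  qed (use d n in auto)
  then show ?thesis using d by blast
qed

end

section \<open>Orbits of bounded jumps and levels with equal data\<close>

lemma Least_cong_upto:
  assumes "P (m::nat)" "m \<le> M" "\<And>i. i \<le> M \<Longrightarrow> P i \<longleftrightarrow> Q i"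
  shows "(LEAST i. P i) = (LEAST i. Q i)"
proof -
  have le: "(LEAST i. P i) \<le> M" using Least_le[of P m] assms by linarith
  have "Q (LEAST i. P i)" using LeastI[of P m] assms le by blast
  moreover have "(LEAST i. P i) \<le> y" if "Q y" for y
  proof (cases "y \<le> M")
    case True
    then show ?thesis using assms that by (intro Least_le) blast
  qed (use le in simp)
  ultimately show ?thesis by (intro Least_equality[symmetric]) auto
qed

text \<open>
  The combinatorial trace of a speedup: from position \<open>k\<close> of \<open>om\<close> one jumps ahead by \<open>P k\<close>, which
  depends on the window of length \<open>L\<close> at \<open>k\<close>.  Injectivity of jumping reflects injectivity of the
  speedup.
\<close>

locale bounded_jumps = aperiodic_positive_subst +
  fixes P :: "nat \<Rightarrow> nat" and L M :: nat
  assumes P_pos: "P k > 0" and P_le: "P k \<le> M"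
    and P_local: "(\<And>i. i < L \<Longrightarrow> om (k + i) = om (k' + i)) \<Longrightarrow> P k = P k'"
    and inj_jump: "inj (\<lambda>k. k + P k)"
begin

definition jump :: "nat \<Rightarrow> nat" where "jump k = k + P k"

definition path :: "nat \<Rightarrow> nat \<Rightarrow> nat" where "path x t = (jump ^^ t) x"

abbreviation orb :: "nat \<Rightarrow> nat" where "orb \<equiv> path 0"

lemma M_pos: "M > 0" using P_pos[of 0] P_le[of 0] by linarith

lemma path_0 [simp]: "path x 0 = x" by (simp add: path_def)

lemma path_Suc: "path x (Suc t) = path x t + P (path x t)" by (simp add: path_def jump_def)

lemma strict_mono_path: "strict_mono (path x)"
  by (rule strict_monoI_Suc) (simp add: path_Suc P_pos)

lemma path_add: "path x (t + u) = path (path x u) t"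
  by (simp add: path_def funpow_add)

lemma path_hits: assumes "x < c" shows "\<exists>m<M. c + m \<in> range (path x)"
proof -
  define t where "t = idx (path x) c"
  have ge: "c \<le> path x t" unfolding t_def by (rule idx_ge[OF strict_mono_path])
  have "t \<noteq> 0" using ge assms by (intro notI) simp
  then obtain u where u: "t = Suc u" using not0_implies_Suc by blast
  have "path x u < c" using idx_less[of u "path x" c] u t_def by simp
  then have "path x t < c + M" using u P_le[of "path x u"] by (simp add: path_Suc)
  then show ?thesis using ge by (intro exI[of _ "path x t - c"]) auto
qed

lemma orb_hits: "\<exists>m<M. c + m \<in> range orb"
proof (cases "c = 0")
  case True
  then show ?thesis using M_pos path_0[of 0] by (metis add_0 rangeI)
qed (use path_hits[of 0 c] in simp)

text \<open>
  By induction along the path: each jump is determined by a window in which the two places agree.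
\<close>

lemma path_shift_imp:
  assumes "\<And>i. i < N + L \<Longrightarrow> om (a + i) = om (a' + i)"
  shows "m \<le> N \<Longrightarrow> a + m \<in> range (path (a + j)) \<Longrightarrow> a' + m \<in> range (path (a' + j))"
proof (induction m rule: less_induct)
  case (less m)
  then obtain t where t: "a + m = path (a + j) t" by auto
  show ?case
  proof (cases t)
    case 0
    then have "m = j" using t by simp
    then show ?thesis using path_0[of "a' + j"] by (metis rangeI)
  next
    case (Suc u)
    have "a + j \<le> path (a + j) u"
      using strict_mono_less_eq[OF strict_mono_path[of "a + j"], of 0 u] by simp
    then obtain m' where m': "path (a + j) u = a + m'" by (metis add.assoc le_Suc_ex)
    have m: "a + m = a + m' + P (a + m')" using t Suc m' by (simp add: path_Suc)
    then have lt: "m' < m" using P_pos[of "a + m'"] by simp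
    have "P (a + m') = P (a' + m')"
    proof (rule P_local)
      fix i assume "i < L"
      then have "m' + i < N + L" using lt less.prems(1) by simp
      then show "om (a + m' + i) = om (a' + m' + i)" using assms[of "m' + i"] by (simp add: add.assoc)
    qed
    moreover have "a' + m' \<in> range (path (a' + j))"
      using less.IH[OF lt] lt less.prems(1) m' by (metis less_imp_le_nat less_le_trans rangeI)
    then obtain w where "a' + m' = path (a' + j) w" by blast
    ultimately have "a' + m = path (a' + j) (Suc w)" using m by (simp add: path_Suc)
    then show ?thesis by simp
  qed
qed

lemma path_shift:
  assumes "\<And>i. i < N + L \<Longrightarrow> om (a + i) = om (a' + i)" "m \<le> N"
  shows "a + m \<in> range (path (a + j)) \<longleftrightarrow> a' + m \<in> range (path (a' + j))"
  using path_shift_imp[of N a a' m j] path_shift_imp[of N a' a m j] assms by metis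

text \<open>
  Three data of the stretch between the cuts \<open>i\<close> and \<open>i + 1\<close> of level \<open>n\<close>: the offset of the first
  point of the orbit of \<open>0\<close> at or after cut \<open>i\<close>; the offset beyond cut \<open>i + 1\<close> at which a path arrives that
  starts at offset \<open>j\<close> from cut \<open>i\<close>; and the return word itself.
\<close>

definition entry :: "nat \<Rightarrow> nat \<Rightarrow> nat" where
  "entry n i = (LEAST m. cs n i + m \<in> range orb)"

definition transit :: "nat \<Rightarrow> nat \<Rightarrow> nat \<Rightarrow> nat" where
  "transit n i j = (LEAST m. cs n (Suc i) + m \<in> range (path (cs n i + j)))"

definition rword :: "nat \<Rightarrow> nat \<Rightarrow> 'a list" where
  "rword n i = map om [cs n i..<cs n (Suc i)]"

lemma entry_in: "cs n i + entry n i \<in> range orb"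
  using orb_hits[of "cs n i"] unfolding entry_def by (metis (mono_tags, lifting) LeastI_ex)

lemma entry_less: "entry n i < M"
  using orb_hits[of "cs n i"] Least_le[of "\<lambda>m. cs n i + m \<in> range orb"] unfolding entry_def
  by (meson le_less_trans)

lemma not_before_entry: "m < entry n i \<Longrightarrow> cs n i + m \<notin> range orb"
  unfolding entry_def by (rule not_less_Least)

lemma entry_0: "entry n 0 = 0"
proof -
  have "0 \<in> range orb" using path_0[of 0] by (metis rangeI)
  then show ?thesis unfolding entry_def by (intro Least_equality) auto
qed

text \<open>
  The orbit from its point of entry onwards is the path that starts there.  Hence \<open>transit\<close> governs
  how the offsets of entry evolve.
\<close>

lemma orb_after_entry:
  "cs n i + m \<in> range orb \<longleftrightarrow> cs n i + m \<in> range (path (cs n i + entry n i))"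
proof -
  obtain t0 where t0: "cs n i + entry n i = orb t0" using entry_in by blast
  show ?thesis
  proof
    assume "cs n i + m \<in> range orb"
    then obtain t where t: "cs n i + m = orb t" by blast
    have "entry n i \<le> m" using not_before_entry[of m n i] \<open>cs n i + m \<in> range orb\<close> by (meson not_less)
    then have "orb t0 \<le> orb t" using t t0 by linarith
    then have "t0 \<le> t" by (simp add: strict_mono_less_eq[OF strict_mono_path])
    then have "orb t = path (orb t0) (t - t0)" using path_add[of 0 "t - t0" t0] by simp
    then show "cs n i + m \<in> range (path (cs n i + entry n i))" using t t0 by simp
  next
    assume "cs n i + m \<in> range (path (cs n i + entry n i))"
    then obtain t where "cs n i + m = path (orb t0) t" using t0 by auto
    then have "cs n i + m = orb (t + t0)" by (simp add: path_add)
    then show "cs n i + m \<in> range orb" by simp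
  qed
qed

lemma entry_Suc: "entry n (Suc i) = transit n i (entry n i)"
proof -
  have "cs n (Suc i) + m \<in> range orb \<longleftrightarrow> cs n (Suc i) + m \<in> range (path (cs n i + entry n i))" for m
  proof -
    have "cs n i \<le> cs n (Suc i)" using strict_mono_cs by (simp add: strict_mono_less_eq)
    then obtain d where "cs n (Suc i) = cs n i + d" using le_Suc_ex by blast
    then show ?thesis using orb_after_entry[of n i "d + m"] by (simp add: add.assoc)
  qed
  then show ?thesis unfolding entry_def[of n "Suc i"] transit_def by simp
qed

text \<open>
  Half of the length \<open>2 * lmax\<close> suffices to reach the next cut after the block of the first letter
  and the other half covers the occurrence of \<open>\<theta>\<^sup>n(l)\<close> at that cut.  \<open>cum n k\<close> is the number of cuts
  before block \<open>k\<close>, and \<open>cnt n k\<close> the number of cuts in block \<open>k\<close>.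
\<close>

definition win :: "nat \<Rightarrow> 'a list" where "win k = map om [k..<k + 2 * lmax]"

definition cum :: "nat \<Rightarrow> nat \<Rightarrow> nat" where "cum n k = idx (cs n) (pos n k)"

definition cnt :: "nat \<Rightarrow> nat \<Rightarrow> nat" where "cnt n k = cum n (Suc k) - cum n k"

lemma cum_0: "cum n 0 = 0" 
  unfolding cum_def using idx_of_value[OF strict_mono_cs, of n 0] by simp

lemma cum_Suc: "cum n (Suc k) = cum n k + cnt n k"
  unfolding cnt_def cum_def using idx_mono[OF strict_mono_cs, of "pos n k" "pos n (Suc k)" n]
  by (simp add: pos_Suc)

lemma cnt_eq_card: "cnt n k = card {c. cut n c \<and> pos n k \<le> c \<and> c < pos n (Suc k)}"
proof -
  have "map (cs n) [cum n k..<cum n (Suc k)] = filter (\<lambda>z. z \<in> range (cs n)) [pos n k..<pos n (Suc k)]"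
    unfolding cum_def by (rule filter_range_interval) (auto simp: strict_mono_cs pos_Suc)
  then have "length (map (cs n) [cum n k..<cum n (Suc k)]) = length (filter (cut n) [pos n k..<pos n (Suc k)])"
    by (simp add: range_cs)
  also have "\<dots> = card (set (filter (cut n) [pos n k..<pos n (Suc k)]))"
    by (rule distinct_card[symmetric]) simp
  also have "set (filter (cut n) [pos n k..<pos n (Suc k)]) = {c. cut n c \<and> pos n k \<le> c \<and> c < pos n (Suc k)}"
    by auto
  finally show ?thesis by (simp add: cnt_def)
qed

lemma index_split: "\<exists>k q. i = cum n k + q \<and> q < cnt n k"
proof -
  obtain k where k: "pos n k \<le> cs n i" "cs n i < pos n (Suc k)"
    using interval_exists[OF strict_mono_pos, of n "cs n i"] by auto
  have "cum n k \<le> i" "i < cum n (Suc k)" using k unfolding cum_def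
    by (simp_all add: idx_le_iff[OF strict_mono_cs] less_idx_iff[OF strict_mono_cs])
  then show ?thesis using cum_Suc by (intro exI[of _ k] exI[of _ "i - cum n k"]) auto
qed

text \<open>
  Equal windows have equal images, and these cover everything that the three conclusions speak of:
  the cuts in the block of the first letter, the cut after each of them together with its occurrence
  of \<open>\<theta>\<^sup>n(l)\<close>, and the jumps in between.
\<close>

lemma win_determines:
  assumes w: "win k = win k'"
  shows "vlen n \<ge> L + M \<Longrightarrow> cnt n k = cnt n k'"
    and "vlen n \<ge> L + M \<Longrightarrow> q < cnt n k \<Longrightarrow> rword n (cum n k + q) = rword n (cum n k' + q)"
    and "vlen n \<ge> L + M \<Longrightarrow> q < cnt n k \<Longrightarrow> (\<And>i. cs n i + M \<le> cs n (Suc i)) \<Longrightarrow> j < M \<Longrightarrow>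
      transit n (cum n k + q) j = transit n (cum n k' + q) j"
proof -
  assume v: "vlen n \<ge> L + M"
  define a where "a = pos n k"
  define a' where "a' = pos n k'"
  define W where "W = pos n (k + 2 * lmax) - a"
  define N where "N = pos n (k + lmax) - a"
  have ag: "om (a + i) = om (a' + i)" if "i < W" for i
    using om_window(2)[of k "2 * lmax" k'] w that unfolding a_def a'_def W_def win_def by blast
  have lp: "0 < lmax" by (rule lmax_pos)
  have aN: "a + N = pos n (k + lmax)" unfolding N_def a_def using pos_mono[of k "k + lmax" n] by simp
  have aW: "a + W = pos n (k + 2 * lmax)" unfolding W_def a_def using pos_mono[of k "k + 2 * lmax" n] by simp
  have NW: "N + vlen n \<le> W" using vlen_le_window[of "k + lmax" n] lp aN aW by (simp add: mult_2 add.assoc)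
  have cut: "a + m \<in> range (cs n) \<longleftrightarrow> a' + m \<in> range (cs n)" if "m \<le> N" for m
  proof -
    have "om (a + m + i) = om (a' + m + i)" if "i < vlen n" for i
      using ag[of "m + i"] that \<open>m \<le> N\<close> NW by (simp add: add.assoc)
    then show ?thesis by (simp add: range_cs cut_def)
  qed
  have om_k: "om k = om k'" using arg_cong[OF w, of "\<lambda>w. w ! 0"] lp by (simp add: win_def)
  define u where "u = length (it n [om k])"
  have u: "pos n (Suc k) = a + u" "pos n (Suc k') = a' + u"
    by (simp_all add: pos_Suc u_def om_k a_def a'_def)
  have uN: "u \<le> N" using u aN pos_mono[of "Suc k" "k + lmax" n] lp by simp
  have "idx (cs n) (a + u) - idx (cs n) (a + 0) = idx (cs n) (a' + u) - idx (cs n) (a' + 0)"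
    using uN by (intro idx_diff_shift[OF strict_mono_cs]) (auto simp: cut)
  then show cnt: "cnt n k = cnt n k'" unfolding cnt_def cum_def u by (simp add: a_def a'_def)
  assume q: "q < cnt n k"
  define i where "i = cum n k + q"
  define i' where "i' = cum n k' + q"
  have "cs n i < a + u" using q unfolding i_def cnt_def cum_def u
    by (simp add: less_idx_iff[OF strict_mono_cs, symmetric] u a_def)
  moreover obtain c where "cut n c" "a + u \<le> c" "c \<le> a + N"
    using cut_in_window[of n k] u aN by auto
  ultimately have nx: "cs n (Suc i) \<le> a + N" using cs_Suc_le[of n c i] by linarith
  have "cs n (idx (cs n) a + q) \<le> a + N"
    using nx strict_mono_less[OF strict_mono_cs, of n i "Suc i"] by (simp add: i_def cum_def a_def)
  from value_shift[OF strict_mono_cs cut this] obtain m where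
    m: "m \<le> N" "cs n i = a + m" "cs n i' = a' + m"
    unfolding i_def i'_def cum_def a_def a'_def by blast
  have "cs n (idx (cs n) a + Suc q) \<le> a + N" using nx by (simp add: i_def cum_def a_def)
  from value_shift[OF strict_mono_cs cut this] obtain m2 where
    m2: "m2 \<le> N" "cs n (Suc i) = a + m2" "cs n (Suc i') = a' + m2"
    unfolding i_def i'_def cum_def a_def a'_def by auto
  show "rword n (cum n k + q) = rword n (cum n k' + q)"
    unfolding rword_def i_def[symmetric] i'_def[symmetric] m m2
    using m2 NW by (intro nth_equalityI) (auto simp: add.assoc ag)
  assume gap: "\<And>i. cs n i + M \<le> cs n (Suc i)" and j: "j < M"
  have "m + M \<le> m2" using gap[of i] m m2 by simp
  then have "cs n i + j < cs n (Suc i)" using m m2 j by simp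
  then obtain h where h: "h < M" "cs n (Suc i) + h \<in> range (path (cs n i + j))"
    using path_hits by blast
  have "transit n i j = transit n i' j" unfolding transit_def
  proof (rule Least_cong_upto)
    fix h assume h: "h \<le> M"
    have "a + (m2 + h) \<in> range (path (a + (m + j))) \<longleftrightarrow> a' + (m2 + h) \<in> range (path (a' + (m + j)))"
      using NW v h m2 by (intro path_shift[of "N + M"]) (auto simp: ag)
    then show "cs n (Suc i) + h \<in> range (path (cs n i + j)) \<longleftrightarrow> cs n (Suc i') + h \<in> range (path (cs n i' + j))"
      by (simp add: m m2 add.assoc)
  qed (use h in auto)
  then show "transit n (cum n k + q) j = transit n (cum n k' + q) j" by (simp add: i_def i'_def)
qed

lemma transit_less:
  assumes "cs n i + M \<le> cs n (Suc i)" "j < M"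
  shows "transit n i j < M"
proof -
  obtain h where h: "h < M" "cs n (Suc i) + h \<in> range (path (cs n i + j))"
    using path_hits[of "cs n i + j" "cs n (Suc i)"] assms by auto
  then show ?thesis unfolding transit_def
    using Least_le[of "\<lambda>m. cs n (Suc i) + m \<in> range (path (cs n i + j))" h] by linarith
qed

text \<open>
  The data of a level as finite relations on windows.  A label \<open>(win k, q)\<close> stands for the \<open>q\<close>-th cut
  in block \<open>k\<close>.
\<close>

definition cut_count_data :: "nat \<Rightarrow> ('a list \<times> nat) set" where
  "cut_count_data n = {(win k, cnt n k) | k. True}"

definition equal_word_data :: "nat \<Rightarrow> (('a list \<times> nat) \<times> ('a list \<times> nat)) set" where
  "equal_word_data n = {((win k, q), (win k', q')) | k q k' q'. q < cnt n k \<and> q' < cnt n k' \<and>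
     rword n (cum n k + q) = rword n (cum n k' + q')}"

definition transit_data :: "nat \<Rightarrow> (('a list \<times> nat) \<times> (nat \<times> nat)) set" where
  "transit_data n = {((win k, q), (j, transit n (cum n k + q) j)) | k q j. q < cnt n k \<and> j < M}"

text \<open>
  By \<open>win_determines\<close> the three relations do not depend on which block with a given window is taken.  By
  \<open>cut_counts\<close> they are subsets of finite sets common to all large levels, so infinitely many levels
  share their data.
  Equal cut counts identify the labels of the \<open>i\<close>-th cut at both levels; the second relation then
  transports equality of return words and the third yields equal entries by induction on \<open>i\<close>.
\<close>

lemma similar_levels:
  "\<exists>n\<ge>n0. (\<forall>i. cs n i + M \<le> cs n (Suc i)) \<and>
    (\<forall>N. \<exists>n'>n. (\<forall>i. cs n' i + N \<le> cs n' (Suc i)) \<and>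
      (\<forall>i i'. rword n i = rword n i' \<longrightarrow> rword n' i = rword n' i') \<and>
      (\<forall>i. entry n i = entry n' i))"
proof -
  obtain d K where d: "\<forall>n\<ge>d. \<forall>c c'. cut n c \<longrightarrow> cut n c' \<longrightarrow> c < c' \<longrightarrow> c + bmin (n - d) < c'"
    and K: "\<forall>n>d. \<forall>k. card {c. cut n c \<and> pos n k \<le> c \<and> c < pos n (Suc k)} \<le> K"
    using cut_counts by blast
  have gap0: "cs n i + (n - d) \<le> cs n (Suc i)" if "n \<ge> d" for n i
    using d[rule_format, OF that cut_cs[of n i] cut_cs[of n "Suc i"]] bmin_gt[of "n - d"]
      strict_mono_less[OF strict_mono_cs, of n i "Suc i"] by simp
  define n1 where "n1 = n0 + d + L + M + 1"
  have gap: "cs n i + M \<le> cs n (Suc i)" if "n \<ge> n1" for n i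
    using gap0[of n i] that by (simp add: n1_def)
  have v: "vlen n \<ge> L + M" if "n \<ge> n1" for n using vlen_gt[of n] that by (simp add: n1_def)
  have cntK: "cnt n k \<le> K" if "n \<ge> n1" for n k
    using K that unfolding cnt_eq_card by (simp add: n1_def)
  define Z where "Z = range win"
  have finZ: "finite Z"
  proof (rule finite_subset)
    show "Z \<subseteq> {w. set w \<subseteq> A \<and> length w = 2 * lmax}" using om_in by (auto simp: Z_def win_def)
    show "finite {w. set w \<subseteq> A \<and> length w = 2 * lmax}" by (rule finite_lists_length_eq[OF finite_A])
  qed
  define T where "T = Pow (Z \<times> {..K}) \<times> Pow ((Z \<times> {..K}) \<times> (Z \<times> {..K})) \<times>
    Pow ((Z \<times> {..K}) \<times> ({..<M} \<times> {..<M}))"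
  define F where "F n = (cut_count_data n, equal_word_data n, transit_data n)" for n
  have FT: "F n \<in> T" if n: "n \<ge> n1" for n
  proof -
    have "cut_count_data n \<subseteq> Z \<times> {..K}" using cntK[OF n] by (auto simp: cut_count_data_def Z_def)
    moreover have "equal_word_data n \<subseteq> (Z \<times> {..K}) \<times> (Z \<times> {..K})"
      using less_le_trans[OF _ cntK[OF n]] by (fastforce simp: equal_word_data_def Z_def)
    moreover have "transit_data n \<subseteq> (Z \<times> {..K}) \<times> ({..<M} \<times> {..<M})"
      using less_le_trans[OF _ cntK[OF n]] transit_less[OF gap[OF n]] by (fastforce simp: transit_data_def Z_def)
    ultimately show ?thesis by (simp add: F_def T_def)
  qed
  have "finite T" unfolding T_def using finZ by simp
  then have "finite (F ` {n1..})" using FT finite_subset[of "F ` {n1..}" T] by auto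
  then obtain n where n: "n \<in> {n1..}" and inf: "infinite {m \<in> {n1..}. F m = F n}"
    using pigeonhole_infinite[OF infinite_Ici] by blast
  have nn1: "n \<ge> n1" using n by simp
  show ?thesis
  proof (rule exI[of _ n], intro conjI allI)
    show "n \<ge> n0" using nn1 by (simp add: n1_def)
    show "cs n i + M \<le> cs n (Suc i)" for i by (rule gap[OF nn1])
    fix N
    obtain n' where n': "n' > max (d + N) n" "n' \<in> {m \<in> {n1..}. F m = F n}"
      using inf unfolding infinite_nat_iff_unbounded by blast
    then have n'1: "n' \<ge> n1" and F: "cut_count_data n = cut_count_data n'" "equal_word_data n = equal_word_data n'" "transit_data n = transit_data n'"
      by (auto simp: F_def)
    have cnt: "cnt n k = cnt n' k" for k
    proof -
      have "(win k, cnt n k) \<in> cut_count_data n'" unfolding F(1)[symmetric] by (auto simp: cut_count_data_def)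
      then obtain k2 where "win k = win k2" "cnt n k = cnt n' k2" unfolding cut_count_data_def by blast
      then show ?thesis using win_determines(1)[of k k2 n'] v[OF n'1] by simp
    qed
    have cum: "cum n k = cum n' k" for k by (induction k) (simp_all add: cum_0 cum_Suc cnt)
    have word: "rword n' i = rword n' i'" if eq: "rword n i = rword n i'" for i i'
    proof -
      obtain k q where kq: "i = cum n k + q" "q < cnt n k" using index_split by blast
      obtain k' q' where kq': "i' = cum n k' + q'" "q' < cnt n k'" using index_split by blast
      have "((win k, q), (win k', q')) \<in> equal_word_data n'" using F(2) kq kq' eq unfolding equal_word_data_def by blast
      then obtain l l' where l: "win k = win l" "win k' = win l'" "q < cnt n' l" "q' < cnt n' l'"
        "rword n' (cum n' l + q) = rword n' (cum n' l' + q')" by (auto simp: equal_word_data_def)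
      have "rword n' (cum n' l + q) = rword n' i"
        using win_determines(2)[of l k n' q] l v[OF n'1] kq by (simp add: cum)
      moreover have "rword n' (cum n' l' + q') = rword n' i'"
        using win_determines(2)[of l' k' n' q'] l v[OF n'1] kq' by (simp add: cum)
      ultimately show ?thesis using l by simp
    qed
    have tr: "transit n i j = transit n' i j" if j: "j < M" for i j
    proof -
      obtain k q where kq: "i = cum n k + q" "q < cnt n k" using index_split by blast
      have "((win k, q), (j, transit n i j)) \<in> transit_data n'" using F(3) kq j unfolding transit_data_def by blast
      then obtain l where l: "win k = win l" "q < cnt n' l" "transit n i j = transit n' (cum n' l + q) j"
        by (auto simp: transit_data_def)
      then show ?thesis using win_determines(3)[of l k n' q j] v[OF n'1] gap[OF n'1] j kq by (simp add: cum)
    qed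
    have entry: "entry n i = entry n' i" for i
      by (induction i) (simp_all add: entry_0 entry_Suc tr entry_less)
    have "cs n' i + N \<le> cs n' (Suc i)" for i using n' gap0[of n' i] by auto
    moreover have "n' > n" using n' by simp
    ultimately show "\<exists>n'>n. (\<forall>i. cs n' i + N \<le> cs n' (Suc i)) \<and>
      (\<forall>i i'. rword n i = rword n i' \<longrightarrow> rword n' i = rword n' i') \<and>
      (\<forall>i. entry n i = entry n' i)"
      using word entry by blast
  qed
qed

end

section \<open>The coded orbit is self-similar\<close>

context positive_subst
begin

text \<open>
  \<open>floor_at n x\<close> is the return word of level \<open>n\<close> that covers position \<open>x\<close>, with the offset of \<open>x\<close> in
  it.  The formulation with distances to the neighbouring cuts makes it comparable at different
  positions.
\<close>

definition behind :: "nat \<Rightarrow> nat \<Rightarrow> nat" where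
  "behind n x = (LEAST m. m \<le> x \<and> cut n (x - m))"

definition ahead :: "nat \<Rightarrow> nat \<Rightarrow> nat" where
  "ahead n x = (LEAST k. 0 < k \<and> cut n (x + k))"

definition floor_at :: "nat \<Rightarrow> nat \<Rightarrow> 'a list \<times> nat" where
  "floor_at n x = (map om [x - behind n x..<x + ahead n x], behind n x)"

lemma behind_eq: assumes "cs n i \<le> x" "x < cs n (Suc i)" shows "behind n x = x - cs n i"
  unfolding behind_def
proof (rule Least_equality)
  show "x - cs n i \<le> x \<and> cut n (x - (x - cs n i))" using assms cut_cs by simp
  fix y assume y: "y \<le> x \<and> cut n (x - y)"
  show "x - cs n i \<le> y"
  proof (rule ccontr)
    assume "\<not> ?thesis"
    then have "cs n i < x - y" using y by linarith
    then have "cs n (Suc i) \<le> x - y" using cs_Suc_le y by blast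
    then show False using assms by linarith
  qed
qed

lemma ahead_eq: assumes "cs n i \<le> x" "x < cs n (Suc i)" shows "ahead n x = cs n (Suc i) - x"
  unfolding ahead_def
proof (rule Least_equality)
  show "0 < cs n (Suc i) - x \<and> cut n (x + (cs n (Suc i) - x))" using assms cut_cs by simp
  fix y assume "0 < y \<and> cut n (x + y)"
  then have "cs n (Suc i) \<le> x + y" using cs_Suc_le[of n "x + y" i] assms by simp
  then show "cs n (Suc i) - x \<le> y" by simp
qed

lemma floor_at_shift:
  assumes cut: "\<And>m. m \<le> N \<Longrightarrow> cut n (a + m) \<longleftrightarrow> cut n (a' + m)"
    and om: "\<And>m. m < N \<Longrightarrow> om (a + m) = om (a' + m)"
    and c: "cut n (a + u)" "cut n (a + u2)" and m: "u \<le> m" "m < u2" "u2 \<le> N"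
  shows "floor_at n (a + m) = floor_at n (a' + m)"
proof -
  have b1: "m - u \<le> a + m \<and> cut n (a + m - (m - u))" using c m by simp
  have k1: "0 < u2 - m \<and> cut n (a + m + (u2 - m))" using c m by simp
  have b: "behind n (a + m) = behind n (a' + m)"
    unfolding behind_def
  proof (rule Least_cong_upto)
    show "m - u \<le> a + m \<and> cut n (a + m - (m - u))" by (rule b1)
    fix i assume i: "i \<le> m - u"
    then have "a + m - i = a + (m - i)" "a' + m - i = a' + (m - i)" by auto
    then show "i \<le> a + m \<and> cut n (a + m - i) \<longleftrightarrow> i \<le> a' + m \<and> cut n (a' + m - i)"
      using i m cut[of "m - i"] by auto
  qed simp
  have k: "ahead n (a + m) = ahead n (a' + m)"
    unfolding ahead_def
  proof (rule Least_cong_upto)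
    show "0 < u2 - m \<and> cut n (a + m + (u2 - m))" by (rule k1)
    fix i assume i: "i \<le> u2 - m"
    then show "0 < i \<and> cut n (a + m + i) \<longleftrightarrow> 0 < i \<and> cut n (a' + m + i)"
      using m cut[of "m + i"] by (simp add: add.assoc)
  qed simp
  have "behind n (a + m) \<le> m - u" unfolding behind_def by (rule Least_le) (rule b1)
  then have bl: "behind n (a + m) \<le> m" by simp
  have "ahead n (a + m) \<le> u2 - m" unfolding ahead_def by (rule Least_le) (rule k1)
  then have kl: "m + ahead n (a + m) \<le> N" using m by linarith
  have "map om [a + m - behind n (a + m)..<a + m + ahead n (a + m)]
      = map om [a' + m - behind n (a + m)..<a' + m + ahead n (a + m)]"
  proof (intro nth_equalityI)
    fix i assume "i < length (map om [a + m - behind n (a + m)..<a + m + ahead n (a + m)])"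
    then have i: "m - behind n (a + m) + i < N" "i < behind n (a + m) + ahead n (a + m)" using bl kl by auto
    have "om (a + (m - behind n (a + m) + i)) = om (a' + (m - behind n (a + m) + i))" by (rule om[OF i(1)])
    then show "map om [a + m - behind n (a + m)..<a + m + ahead n (a + m)] ! i
      = map om [a' + m - behind n (a + m)..<a' + m + ahead n (a + m)] ! i"
      using bl i by (simp add: add.assoc)
  qed (use bl in simp)
  then show ?thesis unfolding floor_at_def b k by simp
qed

end

context bounded_jumps
begin

lemma floor_at_eq:
  assumes "cs n i \<le> x" "x < cs n (Suc i)"
  shows "floor_at n x = (rword n i, x - cs n i)"
  using assms unfolding floor_at_def rword_def by (simp add: behind_eq[OF assms] ahead_eq[OF assms])

text \<open>
  A return word is followed by an occurrence of \<open>\<theta>\<^sup>n(l)\<close>, so equal return words extend to equal words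
  that are longer by \<open>vlen n\<close>.
\<close>

lemma rword_agree:
  assumes "rword n i = rword n i'"
  shows "cs n (Suc i) - cs n i = cs n (Suc i') - cs n i'"
    and "u < cs n (Suc i) - cs n i + vlen n \<Longrightarrow> om (cs n i + u) = om (cs n i' + u)"
proof -
  show l: "cs n (Suc i) - cs n i = cs n (Suc i') - cs n i'"
    using arg_cong[OF assms, of length] by (simp add: rword_def)
  have le: "cs n j \<le> cs n (Suc j)" for j by (simp add: strict_mono_less_eq[OF strict_mono_cs])
  assume u: "u < cs n (Suc i) - cs n i + vlen n"
  show "om (cs n i + u) = om (cs n i' + u)"
  proof (cases "u < cs n (Suc i) - cs n i")
    case True
    then show ?thesis using arg_cong[OF assms, of "\<lambda>w. w ! u"] l by (simp add: rword_def)
  next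
    case False
    define w where "w = u - (cs n (Suc i) - cs n i)"
    have w: "w < vlen n" using u False by (simp add: w_def)
    have "cs n i + u = cs n (Suc i) + w" "cs n i' + u = cs n (Suc i') + w"
      using False le[of i] le[of i'] l by (simp_all add: w_def)
    then show ?thesis using cut_cs[of n "Suc i"] cut_cs[of n "Suc i'"] w by (simp add: cut_def)
  qed
qed

lemma orb_shift:
  assumes "rword n i = rword n i'" "entry n i = entry n i'" "L \<le> vlen n" "m \<le> cs n (Suc i) - cs n i"
  shows "cs n i + m \<in> range orb \<longleftrightarrow> cs n i' + m \<in> range orb"
proof -
  have "cs n i + m \<in> range (path (cs n i + entry n i)) \<longleftrightarrow> cs n i' + m \<in> range (path (cs n i' + entry n i))"
    using assms(3,4) by (intro path_shift[of "cs n (Suc i) - cs n i"] rword_agree(2)[OF assms(1)]) auto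
  then show ?thesis unfolding orb_after_entry by (simp add: assms(2))
qed

lemma orb_not_between: "orb t < x \<Longrightarrow> x < orb (Suc t) \<Longrightarrow> x \<notin> range orb"
  using strict_mono_less[OF strict_mono_path[of 0]] by auto

text \<open>
  If the predecessor of \<open>a + m\<close> lies at or after \<open>a\<close>, its jump can be copied to \<open>a'\<close>, and injectivity
  of jumping identifies the copy with the predecessor of \<open>a' + m\<close>.
\<close>

lemma pred_shift:
  assumes ag: "\<And>u. u < N + L \<Longrightarrow> om (a + u) = om (a' + u)"
    and m: "m \<le> N" "a + m = orb (Suc t)" "a' + m = orb (Suc t')" "orb t = a + m1"
  shows "orb t' = a' + m1"
proof -
  have s: "a + m = a + m1 + P (a + m1)" using m by (simp add: path_Suc)
  then have "m1 < m" using P_pos[of "a + m1"] by simp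
  then have "P (a + m1) = P (a' + m1)"
    using m(1) ag by (intro P_local) (simp add: add.assoc)
  then have "a' + m1 + P (a' + m1) = orb t' + P (orb t')" using s m(3) by (simp add: path_Suc)
  then show ?thesis using injD[OF inj_jump] by metis
qed

text \<open>
  If the orbit visits corresponding positions, its earlier visits correspond too: go back along the
  orbit using \<open>pred_shift\<close> until both places are left simultaneously.
\<close>

lemma strand_unique:
  assumes ag: "\<And>u. u < N + L \<Longrightarrow> om (a + u) = om (a' + u)"
  shows "m \<le> N \<Longrightarrow> a + m \<in> range orb \<Longrightarrow> a' + m \<in> range orb \<Longrightarrow> m' \<le> m \<Longrightarrow>
    (a + m' \<in> range orb \<longleftrightarrow> a' + m' \<in> range orb)"
proof (induction m rule: less_induct)
  case (less m)
  show ?case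
  proof (cases "m' = m")
    case True
    then show ?thesis using less.prems by simp
  next
    case False
    then have lt: "m' < m" using less.prems by simp
    obtain s where "a + m = orb s" using less.prems by blast
    moreover from this have "s \<noteq> 0" using lt by (intro notI) simp
    ultimately obtain t where t: "a + m = orb (Suc t)" using not0_implies_Suc by blast
    obtain s' where "a' + m = orb s'" using less.prems by blast
    moreover from this have "s' \<noteq> 0" using lt by (intro notI) simp
    ultimately obtain t' where t': "a' + m = orb (Suc t')" using not0_implies_Suc by blast
    consider m1 where "orb t = a + m1" "orb t' = a' + m1" | "orb t < a" "orb t' < a'"
    proof (cases "a \<le> orb t \<or> a' \<le> orb t'")
      case True
      then show ?thesis
      proof
        assume "a \<le> orb t"
        then obtain m1 where "orb t = a + m1" using le_Suc_ex by blast
        then show ?thesis using that(1) pred_shift[OF ag less.prems(1) t t'] by blast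
      next
        assume "a' \<le> orb t'"
        then obtain m1 where "orb t' = a' + m1" using le_Suc_ex by blast
        then show ?thesis using that(1) pred_shift[OF ag[symmetric] less.prems(1) t' t] by blast
      qed
    qed (use that in auto)
    then show ?thesis
    proof cases
      case 1
      have m1: "m1 < m" using t 1(1) P_pos[of "orb t"] by (simp add: path_Suc)
      show ?thesis
      proof (cases "m' \<le> m1")
        case True
        have "a + m1 \<in> range orb" "a' + m1 \<in> range orb" using 1 by (metis rangeI)+
        then show ?thesis using less.IH[OF m1] m1 less.prems(1) True by simp
      next
        case False
        then have "a + m' \<notin> range orb" using orb_not_between[of t "a + m'"] t 1 lt by simp
        moreover have "a' + m' \<notin> range orb" using False orb_not_between[of t' "a' + m'"] t' 1 lt by simp
        ultimately show ?thesis by simp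
      qed
    next
      case 2
      have "a + m' \<notin> range orb" using orb_not_between[of t "a + m'"] t 2 lt by simp
      moreover have "a' + m' \<notin> range orb" using orb_not_between[of t' "a' + m'"] t' 2 lt by simp
      ultimately show ?thesis by simp
    qed
  qed
qed

text \<open>
  A floor that the orbit visits therefore determines where the orbit entered the return word.
\<close>

lemma same_floor_same_entry:
  assumes "rword n i = rword n i'" "L \<le> vlen n" "m < cs n (Suc i) - cs n i"
    and "cs n i + m \<in> range orb" "cs n i' + m \<in> range orb"
  shows "entry n i = entry n i'"
  unfolding entry_def
proof (rule Least_cong_upto)
  fix h assume "h \<le> m"
  then show "cs n i + h \<in> range orb \<longleftrightarrow> cs n i' + h \<in> range orb"
    using assms by (intro strand_unique[of "cs n (Suc i) - cs n i" _ _ m] rword_agree(2)[OF assms(1)]) auto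
qed (use assms in auto)

text \<open>
  The floors that the orbit visits between two cuts of level \<open>n\<close> depend only on the surrounding word of
  \<open>om\<close>, on the cuts in it and on the visits of the orbit to it.
\<close>

lemma orb_word_shift:
  assumes cut: "\<And>m. m \<le> N \<Longrightarrow> cut n (a + m) \<longleftrightarrow> cut n (a' + m)"
    and om: "\<And>m. m < N \<Longrightarrow> om (a + m) = om (a' + m)"
    and orb: "\<And>m. m \<le> N \<Longrightarrow> a + m \<in> range orb \<longleftrightarrow> a' + m \<in> range orb"
    and c: "cut n (a + u)" "cut n (a + u2)" and m: "u \<le> u2" "u2 \<le> N"
  shows "map (\<lambda>t. floor_at n (orb t)) [idx orb (a + u)..<idx orb (a + u2)]
       = map (\<lambda>t. floor_at n (orb t)) [idx orb (a' + u)..<idx orb (a' + u2)]"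
proof -
  have e: "map (\<lambda>t. floor_at n (orb t)) [idx orb x..<idx orb y]
     = map (floor_at n) (filter (\<lambda>z. z \<in> range orb) [x..<y])" if "x \<le> y" for x y
    using filter_range_interval[OF strict_mono_path that, of 0, symmetric] by (simp add: o_def)
  have or: "\<And>m. m \<in> {u..<u2} \<Longrightarrow> a + m \<in> range orb \<longleftrightarrow> a' + m \<in> range orb" using orb m by simp
  have "map (floor_at n) (map (\<lambda>m. a + m) (filter (\<lambda>m. a + m \<in> range orb) [u..<u2]))
      = map (floor_at n) (map (\<lambda>m. a' + m) (filter (\<lambda>m. a + m \<in> range orb) [u..<u2]))"
    using floor_at_shift[OF cut om c _ _ m(2)] by auto
  then show ?thesis using m shifted_interval_list[OF or] by (simp only: e add_le_cancel_left)
qed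

text \<open>
  Take levels \<open>n\<close> and \<open>n'\<close> as in \<open>similar_levels\<close>, with gaps at level \<open>n'\<close> so large that each return
  word of level \<open>n'\<close> splits into at least twice as many return words of level \<open>n\<close> as the orbit has
  visits to a return word of level \<open>n\<close>.  The substitution sends the \<open>q\<close>-th visit to the \<open>i\<close>-th return
  word of level \<open>n\<close> to the visits to the factors \<open>2q\<close> and \<open>2q + 1\<close> of the \<open>i\<close>-th return word of level
  \<open>n'\<close>; the last visit takes all remaining factors.  Equal floors have equal return words, equal \<open>q\<close>
  and equal entries, hence equal images.
\<close>

theorem self_similar_orbit:
  "\<exists>n\<ge>n0. \<exists>G. G 0 = 0 \<and> (\<forall>t. G t + 2 \<le> G (Suc t)) \<and>
     (\<forall>t t'. floor_at n (orb t) = floor_at n (orb t') \<longrightarrow>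
        map (\<lambda>t. floor_at n (orb t)) [G t..<G (Suc t)] = map (\<lambda>t. floor_at n (orb t)) [G t'..<G (Suc t')])"
proof -
  obtain n where n: "n \<ge> max n0 L" and gap: "\<And>i. cs n i + M \<le> cs n (Suc i)"
    and sim: "\<And>N. \<exists>n'>n. (\<forall>i. cs n' i + N \<le> cs n' (Suc i)) \<and>
      (\<forall>i i'. rword n i = rword n i' \<longrightarrow> rword n' i = rword n' i') \<and>
      (\<forall>i. entry n i = entry n' i)"
    using similar_levels[of "max n0 L"] by blast
  \<comment> \<open>\<open>B\<close> bounds the length of return words of level \<open>n\<close>, hence also the number of visits to one; a word of length \<open>2 * B * B\<close> has at least \<open>2 * B\<close> such factors\<close>
  define B where "B = (lmax + 1) * bmax n"
  have gapB: "cs n (Suc i) \<le> cs n i + B" for i unfolding B_def by (rule cs_gap_le)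
  have B0: "B > 0" using gapB[of 0] gap[of 0] M_pos by simp
  obtain n' where n': "n' > n" and gap': "\<And>i. cs n' i + 2 * B * B \<le> cs n' (Suc i)"
    and words: "\<And>i i'. rword n i = rword n i' \<Longrightarrow> rword n' i = rword n' i'"
    and entries: "\<And>i. entry n i = entry n' i"
    using sim[of "2 * B * B"] by blast
  have Lv: "L \<le> vlen n" using n vlen_gt[of n] by simp
  then have Lv': "L \<le> vlen n'" using vlen_mono[of n n'] n' by simp
  \<comment> \<open>\<open>T i\<close> is the time of the first visit at or after cut \<open>i\<close> of level \<open>n\<close>; the cut \<open>i\<close> of level \<open>n'\<close> has index \<open>g i\<close> at level \<open>n\<close>\<close>
  define T where "T i = idx orb (cs n i)" for i
  define g where "g i = idx (cs n) (cs n' i)" for i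
  have csg: "cs n (g i) = cs n' i" for i
  proof -
    have "cut n (cs n' i)" using cut_mono[OF _ cut_cs] n' by simp
    then obtain j where "cs n' i = cs n j" using range_cs[of n] by (metis imageE mem_Collect_eq)
    then show ?thesis unfolding g_def using idx_of_value[OF strict_mono_cs] by metis
  qed
  have orbT: "cs n i \<le> orb (T i)" for i unfolding T_def by (rule idx_ge[OF strict_mono_path])
  have T_mono: "strict_mono T"
  proof (rule strict_monoI_Suc)
    fix i
    obtain m where m: "m < M" "cs n i + m \<in> range orb" using orb_hits by blast
    then obtain t where t: "cs n i + m = orb t" by blast
    then have "T i \<le> t" unfolding T_def by (metis idx_le le_add1)
    moreover have "t < T (Suc i)" unfolding T_def less_idx_iff[OF strict_mono_path]
      using t m gap[of i] by simp
    ultimately show "T i < T (Suc i)" by simp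
  qed
  have T0: "T 0 = 0" unfolding T_def using idx_of_value[OF strict_mono_path, of 0 0] by simp
  have g0: "g 0 = 0" unfolding g_def using idx_of_value[OF strict_mono_cs, of n 0] by simp
  have T_block: "T i \<le> t \<longleftrightarrow> cs n i \<le> orb t" "t < T i \<longleftrightarrow> orb t < cs n i" for i t
    unfolding T_def by (simp_all add: idx_le_iff[OF strict_mono_path] less_idx_iff[OF strict_mono_path])
  have h_le: "T (Suc i) - T i \<le> B" for i
  proof -
    have "map orb [T i..<T (Suc i)] = filter (\<lambda>z. z \<in> range orb) [cs n i..<cs n (Suc i)]"
      unfolding T_def using gap[of i] by (intro filter_range_interval[OF strict_mono_path]) simp
    then have "length (map orb [T i..<T (Suc i)]) \<le> length [cs n i..<cs n (Suc i)]"
      by (metis length_filter_le)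
    then show ?thesis using gapB[of i] by simp
  qed
  have cs_le: "cs n (i + k) \<le> cs n i + k * B" for i k
  proof (induction k)
    case (Suc k)
    then show ?case using gapB[of "i + k"] by simp
  qed simp
  have g_gap: "g i + 2 * B \<le> g (Suc i)" for i
  proof -
    have "cs n' i < cs n' (Suc i)" using strict_mono_less[OF strict_mono_cs] by blast
    then have "g i < g (Suc i)"
      using strict_mono_less[OF strict_mono_cs, of n "g i" "g (Suc i)"] by (simp only: csg)
    then obtain k where k: "g (Suc i) = g i + k" using le_Suc_ex[OF less_imp_le] by metis
    have "2 * B * B \<le> k * B" 
      using cs_le[of "g i" k] gap'[of i] unfolding k[symmetric] csg by linarith
    then have "2 * B \<le> k" using B0 by (metis mult_le_cancel2)
    then show ?thesis using k by linarith
  qed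
  \<comment> \<open>the visit at time \<open>t\<close> is a visit to the return word with index \<open>bl t\<close>\<close>
  define bl where "bl t = (SOME i. T i \<le> t \<and> t < T (Suc i))" for t
  have bl: "T (bl t) \<le> t" "t < T (Suc (bl t))" for t
    unfolding bl_def using someI_ex[OF interval_exists[OF T_mono]] T0 by auto
  have bl_eq: "bl t = i" if "T i \<le> t" "t < T (Suc i)" for t i
    using interval_unique[OF T_mono bl that] .
  define G where "G t = T (g (bl t) + 2 * (t - T (bl t)))" for t
  have next_cases: "(bl (Suc t) = bl t \<and> Suc t < T (Suc (bl t))) \<or>
      (Suc t = T (Suc (bl t)) \<and> bl (Suc t) = Suc (bl t))" for t
  proof (cases "Suc t < T (Suc (bl t))")
    case True
    then show ?thesis using bl[of t] bl_eq[of "bl t" "Suc t"] by simp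
  next
    case False
    then have "Suc t = T (Suc (bl t))" using bl[of t] by simp
    then show ?thesis using bl_eq[of "Suc (bl t)" "Suc t"] T_mono by (simp add: strict_mono_less)
  qed
  \<comment> \<open>index of the cut where the image of \<open>t + 1\<close> begins\<close>
  define e where "e t = (if Suc t < T (Suc (bl t)) then g (bl t) + 2 * Suc (t - T (bl t)) else g (Suc (bl t)))" for t
  have G_Suc: "G (Suc t) = T (e t)" for t
    using next_cases[of t] bl[of t] by (auto simp: G_def e_def Suc_diff_le)
  have q_le: "2 * (t - T (bl t)) + 2 \<le> 2 * B" for t
    using bl[of t] h_le[of "bl t"] by linarith
  have e_gt: "g (bl t) + 2 * (t - T (bl t)) + 2 \<le> e t" for t
    using g_gap[of "bl t"] q_le[of t] by (auto simp: e_def)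
  have e_le: "e t \<le> g (Suc (bl t))" for t
  proof (cases "Suc t < T (Suc (bl t))")
    case True
    then have "2 * Suc (t - T (bl t)) \<le> 2 * B" using q_le[of t] by simp
    then show ?thesis using True g_gap[of "bl t"] unfolding e_def by simp
  qed (simp add: e_def)
  have T_gap: "T i + k \<le> T (i + k)" for i k
  proof (induction k)
    case (Suc k)
    then show ?case using strict_mono_less[OF T_mono, of "i + k" "Suc (i + k)"] by simp
  qed simp
  have step: "G t + 2 \<le> G (Suc t)" for t
  proof -
    have "G t + 2 \<le> T (g (bl t) + 2 * (t - T (bl t)) + 2)" unfolding G_def by (rule T_gap)
    also have "\<dots> \<le> T (e t)" using e_gt[of t] strict_mono_less_eq[OF T_mono] by blast
    finally show ?thesis by (simp add: G_Suc)
  qed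
  have G0: "G 0 = 0"
  proof -
    have "bl 0 = 0" using T0 strict_mono_less[OF T_mono, of 0 "Suc 0"] by (intro bl_eq) auto
    then show ?thesis by (simp add: G_def T0 g0)
  qed
  have "map (\<lambda>t. floor_at n (orb t)) [G t..<G (Suc t)] = map (\<lambda>t. floor_at n (orb t)) [G t'..<G (Suc t')]"
    if fl: "floor_at n (orb t) = floor_at n (orb t')" for t t'
  proof -
    define i where "i = bl t"
    define i' where "i' = bl t'"
    have b: "cs n i \<le> orb t" "orb t < cs n (Suc i)" "cs n i' \<le> orb t'" "orb t' < cs n (Suc i')"
      using bl[of t] bl[of t'] T_block unfolding i_def i'_def by blast+
    have w: "rword n i = rword n i'" and d: "orb t - cs n i = orb t' - cs n i'"
      using fl floor_at_eq[OF b(1,2)] floor_at_eq[OF b(3,4)] by auto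
    define m where "m = orb t - cs n i"
    have ot: "orb t = cs n i + m" "orb t' = cs n i' + m" using b d by (simp_all add: m_def)
    have m_lt: "m < cs n (Suc i) - cs n i" using b by (simp add: m_def)
    have en: "entry n i = entry n i'"
      using same_floor_same_entry[OF w Lv m_lt] ot by (metis rangeI)
    have osh: "cs n i + h \<in> range orb \<longleftrightarrow> cs n i' + h \<in> range orb" if "h \<le> cs n (Suc i) - cs n i" for h
      by (rule orb_shift[OF w en Lv that])
    have q: "t - T i = t' - T i'"
    proof -
      have "idx orb (cs n i + m) - idx orb (cs n i + 0) = idx orb (cs n i' + m) - idx orb (cs n i' + 0)"
        using osh m_lt by (intro idx_diff_shift[OF strict_mono_path]) auto
      then show ?thesis unfolding T_def
        using ot idx_of_value[OF strict_mono_path[of 0]] by (metis add_0_right)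
    qed
    have h: "T (Suc i) - T i = T (Suc i') - T i'"
    proof -
      define N where "N = cs n (Suc i) - cs n i"
      have N: "cs n (Suc i) = cs n i + N" "cs n (Suc i') = cs n i' + N"
        using rword_agree(1)[OF w] gap[of i] gap[of i'] by (simp_all add: N_def)
      have "idx orb (cs n i + N) - idx orb (cs n i + 0) = idx orb (cs n i' + N) - idx orb (cs n i' + 0)"
        using osh by (intro idx_diff_shift[OF strict_mono_path]) (auto simp: N_def)
      then show ?thesis by (simp add: T_def N)
    qed
    have last: "Suc t < T (Suc i) \<longleftrightarrow> Suc t' < T (Suc i')"
    proof -
      have "T i \<le> t" "t < T (Suc i)" "T i' \<le> t'" "t' < T (Suc i')" 
        using bl[of t] bl[of t'] by (simp_all add: i_def i'_def)
      then show ?thesis using q h by linarith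
    qed
    have w': "rword n' i = rword n' i'" by (rule words[OF w])
    have en': "entry n' i = entry n' i'" using en entries by simp
    define a where "a = cs n' i"
    define a' where "a' = cs n' i'"
    define N where "N = cs n' (Suc i) - cs n' i"
    have om: "om (a + u) = om (a' + u)" if "u < N + vlen n'" for u
      unfolding a_def a'_def by (rule rword_agree(2)[OF w']) (use that in \<open>simp add: N_def\<close>)
    have N: "cs n (g (Suc i)) = a + N" "cs n (g (Suc i')) = a' + N"
      using rword_agree(1)[OF w'] gap'[of i] gap'[of i'] by (simp_all add: csg N_def a_def a'_def)
    have orb: "a + u \<in> range orb \<longleftrightarrow> a' + u \<in> range orb" if "u \<le> N" for u
      unfolding a_def a'_def by (rule orb_shift[OF w' en' Lv']) (use that in \<open>simp add: N_def\<close>)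
    have cut: "cut n (a + u) \<longleftrightarrow> cut n (a' + u)" if "u \<le> N" for u
    proof -
      have "om (a + u + j) = om (a' + u + j)" if "j < vlen n" for j
        using om[of "u + j"] that \<open>u \<le> N\<close> vlen_mono[of n n'] n' by (simp add: add.assoc)
      then show ?thesis by (simp add: cut_def)
    qed
    then have cutr: "a + u \<in> range (cs n) \<longleftrightarrow> a' + u \<in> range (cs n)" if "u \<le> N" for u
      using that by (simp add: range_cs)
    have cs_shift: "\<exists>u\<le>N. cs n (g i + k) = a + u \<and> cs n (g i' + k) = a' + u" if "g i + k \<le> g (Suc i)" for k
    proof -
      have "cs n (g i + k) \<le> a + N" using that N(1) strict_mono_less_eq[OF strict_mono_cs] by metis
      then show ?thesis using value_shift[OF strict_mono_cs cutr, of N k] unfolding g_def a_def a'_def by blast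
    qed
    have "e t \<ge> g i" using e_gt[of t] by (simp add: i_def)
    then obtain k where k: "e t = g i + k" using le_Suc_ex by blast
    obtain u where u: "u \<le> N" "cs n (g i + 2 * (t - T i)) = a + u" "cs n (g i' + 2 * (t - T i)) = a' + u"
      using cs_shift[of "2 * (t - T i)"] e_gt[of t] e_le[of t] by (auto simp: i_def)
    obtain u2 where u2: "u2 \<le> N" "cs n (e t) = a + u2" "cs n (e t') = a' + u2"
    proof (cases "Suc t < T (Suc i)")
      case True
      then have et: "e t = g i + 2 * Suc (t - T i)" "e t' = g i' + 2 * Suc (t - T i)"
        using last q by (simp_all add: e_def i_def[symmetric] i'_def[symmetric])
      have "e t \<le> g (Suc i)" using e_le[of t] by (simp add: i_def)
      then show ?thesis using that cs_shift[of "2 * Suc (t - T i)"] et by metis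
    next
      case False
      then have "e t = g (Suc i)" "e t' = g (Suc i')"
        using last by (simp_all add: e_def i_def[symmetric] i'_def[symmetric])
      then show ?thesis using that[of N] N by simp
    qed
    have "g i + 2 * (t - T i) \<le> e t" using e_gt[of t] by (simp add: i_def)
    then have "a + u \<le> a + u2" using u2(2) u(2) strict_mono_less_eq[OF strict_mono_cs] by metis
    then have uu: "u \<le> u2" by simp
    have c: "cut n (a + u)" "cut n (a + u2)" using u u2 cut_cs by metis+
    have G: "G t = idx orb (a + u)" "G (Suc t) = idx orb (a + u2)"
      "G t' = idx orb (a' + u)" "G (Suc t') = idx orb (a' + u2)"
      using u u2 q unfolding G_Suc by (simp_all add: G_def T_def i_def i'_def)
    show ?thesis unfolding G
      by (rule orb_word_shift[OF cut om orb c uu u2(1)]) auto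
  qed
  moreover have "n \<ge> n0" using n by simp
  ultimately show ?thesis using step G0 by blast
qed

end

section \<open>Substitutions generated by self-similar sequences\<close>

text \<open>
  The substitution \<open>\<tau>\<close> that maps the symbol \<open>\<zeta> t\<close> to the stretch of \<open>\<zeta>\<close> from \<open>G t\<close> to \<open>G (t + 1)\<close> is
  well-defined and fixes \<open>\<zeta>\<close>.  Images of length at least two make it growing, and uniform recurrence
  then makes it primitive.
\<close>

locale self_similar =
  fixes \<zeta> :: "nat \<Rightarrow> 'b" and G :: "nat \<Rightarrow> nat"
  assumes finite_range: "finite (range \<zeta>)"
    and G_0: "G 0 = 0" and G_step: "G t + 2 \<le> G (Suc t)"
    and similar: "\<zeta> t = \<zeta> t' \<Longrightarrow> map \<zeta> [G t..<G (Suc t)] = map \<zeta> [G t'..<G (Suc t')]"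
    and recurrent: "\<exists>N. \<forall>t. \<exists>u. t \<le> u \<and> u < t + N \<and> \<zeta> u = \<zeta> t0"
begin

definition \<tau> :: "'b \<Rightarrow> 'b list" where
  "\<tau> b = (let s = SOME s. \<zeta> s = b in map \<zeta> [G s..<G (Suc s)])"

lemma \<tau>_value: "\<tau> (\<zeta> t) = map \<zeta> [G t..<G (Suc t)]"
proof -
  have "\<zeta> (SOME s. \<zeta> s = \<zeta> t) = \<zeta> t" by (rule someI[of "\<lambda>s. \<zeta> s = \<zeta> t" t]) simp
  then show ?thesis unfolding \<tau>_def Let_def by (rule similar)
qed

lemma G_spread: "a \<le> b \<Longrightarrow> G a + 2 * (b - a) \<le> G b"
proof (induction b rule: dec_induct)
  case (step b)
  then show ?case using G_step[of b] by (simp add: Suc_diff_le)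
qed simp

lemma subst_word_segment: "a \<le> b \<Longrightarrow> subst_word \<tau> (map \<zeta> [a..<b]) = map \<zeta> [G a..<G b]"
proof (induction b rule: dec_induct)
  case base show ?case by (simp add: subst_word_def)
next
  case (step b)
  have "G a \<le> G b" "G b \<le> G (Suc b)" using G_spread[of a b] G_step[of b] step by auto
  then have "[G a..<G (Suc b)] = [G a..<G b] @ [G b..<G (Suc b)]"
    using upt_add_eq_append[of "G a" "G b" "G (Suc b) - G b"] by simp
  moreover have "subst_word \<tau> (map \<zeta> [a..<Suc b]) = subst_word \<tau> (map \<zeta> [a..<b]) @ \<tau> (\<zeta> b)"
    using step by (simp add: subst_word_def)
  ultimately show ?case using step by (simp add: \<tau>_value)
qed

lemma G_pow_mono: "a \<le> b \<Longrightarrow> (G ^^ k) a + 2 ^ k * (b - a) \<le> (G ^^ k) b"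
proof (induction k)
  case (Suc k)
  then have IH: "(G ^^ k) a + 2 ^ k * (b - a) \<le> (G ^^ k) b" by simp
  then have "G ((G ^^ k) a) + 2 * ((G ^^ k) b - (G ^^ k) a) \<le> G ((G ^^ k) b)"
    by (intro G_spread) simp
  moreover have "2 ^ Suc k * (b - a) \<le> 2 * ((G ^^ k) b - (G ^^ k) a)" using IH by simp
  ultimately show ?case by simp
qed simp

lemma iter_segment: "a \<le> b \<Longrightarrow> (subst_word \<tau> ^^ k) (map \<zeta> [a..<b]) = map \<zeta> [(G ^^ k) a..<(G ^^ k) b]"
proof (induction k)
  case (Suc k)
  have "(G ^^ k) a \<le> (G ^^ k) b" using G_pow_mono[OF Suc.prems, of k] by simp
  then show ?case using Suc by (simp add: subst_word_segment)
qed simp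

lemma subst_iter_value: "subst_iter \<tau> k (\<zeta> t) = map \<zeta> [(G ^^ k) t..<(G ^^ k) (Suc t)]"
  using iter_segment[of t "Suc t" k] by (simp add: subst_iter_def)

lemma length_subst_iter: "2 ^ k \<le> length (subst_iter \<tau> k (\<zeta> t))"
  using G_pow_mono[of t "Suc t" k] by (simp add: subst_iter_value)

lemma substitution: "substitution (range \<zeta>) \<tau>"
  using finite_range \<tau>_value by (auto simp: substitution_def)

lemma primitive: "primitive_subst (range \<zeta>) \<tau>"
  unfolding primitive_subst_def
proof (intro conjI ballI)
  fix a b assume "a \<in> range \<zeta>" "b \<in> range \<zeta>"
  then obtain t t0 where ab: "a = \<zeta> t" "b = \<zeta> t0" by blast
  obtain N where N: "\<And>t. \<exists>u. t \<le> u \<and> u < t + N \<and> \<zeta> u = \<zeta> t0" using recurrent by blast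
  obtain u where u: "(G ^^ N) t \<le> u" "u < (G ^^ N) t + N" "\<zeta> u = b" using N ab by blast
  have "(G ^^ N) t + 2 ^ N \<le> (G ^^ N) (Suc t)" using G_pow_mono[of t "Suc t" N] by simp
  then have "u < (G ^^ N) (Suc t)" using u less_exp[of N] by linarith
  then have "\<zeta> u \<in> set (subst_iter \<tau> N a)" using u(1) unfolding ab(1) subst_iter_value by simp
  then have "b \<in> set (subst_iter \<tau> N a)" by (simp add: u(3))
  then show "\<exists>k. b \<in> set (subst_iter \<tau> k a)" by blast
next
  fix a assume "a \<in> range \<zeta>"
  then obtain t where t: "a = \<zeta> t" by blast
  have "k \<le> length (subst_iter \<tau> k a)" for k
    using less_exp[of k] length_subst_iter[of k t] unfolding t by linarith
  then show "filterlim (\<lambda>k. length (subst_iter \<tau> k a)) at_top sequentially"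
    by (intro filterlim_at_top_mono[OF filterlim_ident]) auto
qed

text \<open>
  The words \<open>\<tau>\<^sup>k(\<zeta> t)\<close> are stretches of \<open>\<zeta>\<close>, and conversely \<open>\<tau>\<^sup>k(\<zeta> 0)\<close> is a prefix of \<open>\<zeta>\<close> whose length
  tends to infinity.
\<close>

lemma points: "subst_points (range \<zeta>) \<tau> = {y. \<forall>i N. \<exists>c. \<forall>q<N. y (i + int q) = \<zeta> (c + q)}"
proof (intro set_eqI iffI CollectI allI)
  fix y i N assume y: "y \<in> subst_points (range \<zeta>) \<tau>"
  have "i < i + int (Suc N)" by simp
  then obtain k a where "a \<in> range \<zeta>" "sublist (map y [i..i + int (Suc N)]) (subst_iter \<tau> k a)"
    using y unfolding subst_points_def by blast
  then obtain t where "sublist (map y [i..i + int (Suc N)]) (map \<zeta> [(G ^^ k) t..<(G ^^ k) (Suc t)])"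
    by (auto simp: subst_iter_value)
  from sublist_nth_offset[OF this] obtain c where
    c: "c + length (map y [i..i + int (Suc N)]) \<le> length (map \<zeta> [(G ^^ k) t..<(G ^^ k) (Suc t)])"
      "\<And>q. q < length (map y [i..i + int (Suc N)]) \<Longrightarrow>
         map y [i..i + int (Suc N)] ! q = map \<zeta> [(G ^^ k) t..<(G ^^ k) (Suc t)] ! (c + q)" by blast
  have "y (i + int q) = \<zeta> ((G ^^ k) t + c + q)" if "q < N" for q
    using c(1) c(2)[of q] that by (simp add: nth_upto add.assoc)
  then show "\<exists>c. \<forall>q<N. y (i + int q) = \<zeta> (c + q)" by blast
next
  fix y assume "y \<in> {y. \<forall>i N. \<exists>c. \<forall>q<N. y (i + int q) = \<zeta> (c + q)}"
  then have y: "\<exists>c. \<forall>q<N. y (i + int q) = \<zeta> (c + q)" for i N by blast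
  have "y i \<in> range \<zeta>" for i using y[of "Suc 0" i] by auto
  moreover have "\<exists>k. \<exists>a\<in>range \<zeta>. sublist (map y [i..j]) (subst_iter \<tau> k a)" if "i < j" for i j
  proof -
    define N where "N = nat (j - i + 1)"
    obtain c where c: "\<forall>q<N. y (i + int q) = \<zeta> (c + q)" using y by blast
    let ?k = "c + N"
    have G0k: "(G ^^ k) 0 = 0" for k by (induction k) (simp_all add: G_0)
    have "2 ^ ?k \<le> (G ^^ ?k) (Suc 0)" using G_pow_mono[of 0 "Suc 0" ?k] by (simp add: G0k)
    then have "c + N \<le> (G ^^ ?k) (Suc 0)" using less_exp[of ?k] by linarith
    then have "sublist (map y [i..j]) (map \<zeta> [(G ^^ ?k) 0..<(G ^^ ?k) (Suc 0)])"
      using c that by (intro sublist_of_nth_offset[of c]) (auto simp: G0k N_def nth_upto)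
    then show ?thesis using subst_iter_value[of ?k 0] by (metis rangeI)
  qed
  ultimately show "y \<in> subst_points (range \<zeta>) \<tau>" unfolding subst_points_def by blast
qed

end

section \<open>The topology of a substitution space\<close>

lemma subst_points_in: "x \<in> subst_points A \<theta> \<Longrightarrow> x i \<in> A"
  by (auto simp: subst_points_def)

lemma translate_in_subst_points:
  assumes "x \<in> subst_points A \<theta>" shows "(\<lambda>i. x (i + k)) \<in> subst_points A \<theta>"
proof -
  have "\<exists>m. \<exists>a\<in>A. sublist (map (\<lambda>i. x (i + k)) [i..j]) (subst_iter \<theta> m a)" if "i < j" for i j
  proof -
    have "map (\<lambda>i. x (i + k)) [i..j] = map x [i + k..j + k]"
      by (intro nth_equalityI) (auto simp: nth_upto algebra_simps)
    moreover have "i + k < j + k" using that by simp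
    ultimately show ?thesis using assms unfolding subst_points_def by auto
  qed
  then show ?thesis using assms unfolding subst_points_def by auto
qed

definition agree :: "nat \<Rightarrow> (int \<Rightarrow> 'a) \<Rightarrow> (int \<Rightarrow> 'a) \<Rightarrow> bool" where
  "agree R x y \<longleftrightarrow> (\<forall>i. \<bar>i\<bar> \<le> int R \<longrightarrow> x i = y i)"

lemma openin_full_cylinder:
  assumes "range x \<subseteq> A"
  shows "openin (product_topology (\<lambda>_::int. discrete_topology A) UNIV) {y. range y \<subseteq> A \<and> agree R x y}"
proof -
  have e: "{y. range y \<subseteq> A \<and> agree R x y} = (\<Pi>\<^sub>E i\<in>UNIV. if \<bar>i\<bar> \<le> int R then {x i} else A)"
    using assms by (auto simp: agree_def PiE_iff split: if_splits) fastforce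
  have "finite {i. (if \<bar>i\<bar> \<le> int R then {x i} else A) \<noteq> A}"
    by (rule finite_subset[of _ "{- int R..int R}"]) auto
  then show ?thesis unfolding e using assms by (subst openin_PiE_gen) auto
qed

lemma openin_cylinder:
  assumes "x \<in> subst_points A \<theta>"
  shows "openin (subst_space A \<theta>) {y \<in> subst_points A \<theta>. agree R x y}"
proof -
  have "range x \<subseteq> A" using assms by (auto simp: subst_points_def)
  from openin_full_cylinder[OF this, of R] show ?thesis
    unfolding subst_space_def openin_subtopology
    by (intro exI[of _ "{y. range y \<subseteq> A \<and> agree R x y}"]) (auto simp: subst_points_def)
qed

lemma open_contains_cylinder:
  assumes "openin (subst_space A \<theta>) U" "x \<in> U"
  shows "\<exists>R. \<forall>y\<in>subst_points A \<theta>. agree R x y \<longrightarrow> y \<in> U"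
proof -
  obtain V where V: "openin (product_topology (\<lambda>_::int. discrete_topology A) UNIV) V"
    "U = V \<inter> subst_points A \<theta>" using assms(1) unfolding subst_space_def openin_subtopology by blast
  then obtain W where W: "finite {i. W i \<noteq> A}" "x \<in> (\<Pi>\<^sub>E i\<in>UNIV. W i)" "(\<Pi>\<^sub>E i\<in>UNIV. W i) \<subseteq> V"
    using assms(2) unfolding openin_product_topology_alt by fastforce
  obtain R where R: "\<And>i. W i \<noteq> A \<Longrightarrow> \<bar>i\<bar> \<le> int R"
  proof -
    have "finite ((\<lambda>i. nat \<bar>i\<bar>) ` {i. W i \<noteq> A})" using W(1) by simp
    then obtain R where "\<forall>m \<in> (\<lambda>i. nat \<bar>i\<bar>) ` {i. W i \<noteq> A}. m \<le> R" using finite_nat_set_iff_bounded_le by blast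
    then show ?thesis by (intro that[of R]) auto
  qed
  have "y \<in> U" if y: "y \<in> subst_points A \<theta>" "agree R x y" for y
  proof -
    have "y i \<in> W i" for i
    proof (cases "W i = A")
      case False
      then have "y i = x i" using R y(2) by (simp add: agree_def)
      then show ?thesis using W(2) by (auto simp: PiE_iff)
    qed (use subst_points_in[OF y(1)] in simp)
    then have "y \<in> V" using W(3) by (auto simp: PiE_iff)
    then show ?thesis using V y by blast
  qed
  then show ?thesis by blast
qed

text \<open>
  A sequence over \<open>A\<close> outside the substitution space contains a forbidden word, which excludes the
  whole cylinder of that word.
\<close>

lemma closedin_subst_points:
  "closedin (product_topology (\<lambda>_::int. discrete_topology A) UNIV) (subst_points A \<theta>)"
proof -
  let ?P = "product_topology (\<lambda>_::int. discrete_topology A) UNIV"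
  have "\<exists>T. openin ?P T \<and> x \<in> T \<and> T \<subseteq> topspace ?P - subst_points A \<theta>"
    if x: "x \<in> topspace ?P - subst_points A \<theta>" for x
  proof -
    have r: "range x \<subseteq> A" using x by (auto simp: PiE_iff)
    then obtain i j where ij: "i < j" "\<not> (\<exists>k. \<exists>a\<in>A. sublist (map x [i..j]) (subst_iter \<theta> k a))"
      using x by (auto simp: subst_points_def)
    define R where "R = nat (max \<bar>i\<bar> \<bar>j\<bar>)"
    have "y \<notin> subst_points A \<theta>" if "agree R x y" for y
    proof -
      have "y t = x t" if "t \<in> {i..j}" for t
      proof -
        have "\<bar>t\<bar> \<le> int R" using that by (auto simp: R_def)
        then show ?thesis using \<open>agree R x y\<close> by (simp add: agree_def)
      qed
      then have e: "map y [i..j] = map x [i..j]" by simp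
      show ?thesis
      proof
        assume "y \<in> subst_points A \<theta>"
        then have "\<exists>k. \<exists>a\<in>A. sublist (map y [i..j]) (subst_iter \<theta> k a)"
          using ij(1) by (simp add: subst_points_def)
        then show False using ij(2) unfolding e by blast
      qed
    qed
    then show ?thesis using openin_full_cylinder[OF r, of R] r
      by (intro exI[of _ "{y. range y \<subseteq> A \<and> agree R x y}"]) (auto simp: PiE_iff agree_def)
  qed
  then have "openin ?P (topspace ?P - subst_points A \<theta>)" by (subst openin_subopen) blast
  then show ?thesis unfolding closedin_def by (auto simp: subst_points_def PiE_iff)
qed

lemma compact_subst_space: "finite A \<Longrightarrow> compact_space (subst_space A \<theta>)"
  unfolding subst_space_def
  by (intro compact_space_subtopology closedin_compact_space[OF _ closedin_subst_points])
     (simp add: compact_space_product_topology compact_space_discrete_topology)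

lemma Hausdorff_subst_space: "Hausdorff_space (subst_space A \<theta>)"
  unfolding subst_space_def
  by (intro Hausdorff_space_subtopology) (simp add: Hausdorff_space_product_topology)

lemma continuous_into_subst_space:
  assumes "\<And>x. x \<in> topspace X \<Longrightarrow> f x \<in> subst_points A \<theta>"
    and "\<And>i. continuous_map X (discrete_topology UNIV) (\<lambda>x. f x i)"
  shows "continuous_map X (subst_space A \<theta>) f"
proof -
  have "continuous_map X (discrete_topology A) (\<lambda>x. f x i)" for i
  proof -
    have "continuous_map X (subtopology (discrete_topology UNIV) A) (\<lambda>x. f x i)"
      unfolding continuous_map_in_subtopology
      using assms subst_points_in[OF assms(1)] by blast
    then show ?thesis by (simp add: subtopology_eq_discrete_topology_eq)
  qed
  then show ?thesis unfolding subst_space_def continuous_map_in_subtopology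
    using assms(1) by (auto simp: continuous_map_componentwise_UNIV)
qed

lemma continuous_locally_constant:
  fixes f :: "(int \<Rightarrow> 'a) \<Rightarrow> 'b"
  assumes "\<And>x y. x \<in> subst_points A \<theta> \<Longrightarrow> y \<in> subst_points A \<theta> \<Longrightarrow> agree R x y \<Longrightarrow> f x = f y"
  shows "continuous_map (subst_space A \<theta>) (discrete_topology UNIV) f"
  unfolding continuous_map
proof (intro conjI allI impI)
  fix U :: "'b set" assume "openin (discrete_topology UNIV) U"
  show "openin (subst_space A \<theta>) {x \<in> topspace (subst_space A \<theta>). f x \<in> U}"
  proof (subst openin_subopen, intro ballI)
    fix x assume x: "x \<in> {x \<in> topspace (subst_space A \<theta>). f x \<in> U}"
    then have "openin (subst_space A \<theta>) {y \<in> subst_points A \<theta>. agree R x y}"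
      by (intro openin_cylinder) simp
    moreover have "{y \<in> subst_points A \<theta>. agree R x y} \<subseteq> {x \<in> topspace (subst_space A \<theta>). f x \<in> U}"
      using assms x by fastforce
    ultimately show "\<exists>T. openin (subst_space A \<theta>) T \<and> x \<in> T \<and> T \<subseteq> {x \<in> topspace (subst_space A \<theta>). f x \<in> U}"
      using x by (intro exI[of _ "{y \<in> subst_points A \<theta>. agree R x y}"]) (auto simp: agree_def)
  qed
qed auto

lemma continuous_translate:
  "continuous_map (subst_space A \<theta>) (subst_space A \<theta>) (\<lambda>x i. x (i + k))"
proof (rule continuous_into_subst_space)
  fix i
  show "continuous_map (subst_space A \<theta>) (discrete_topology UNIV) (\<lambda>x. x (i + k))"
    by (rule continuous_locally_constant[where R = "nat \<bar>i + k\<bar>"]) (simp add: agree_def)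
qed (simp add: translate_in_subst_points)

text \<open>
  Finitely many cylinders on which \<open>f\<close> is constant cover the space; take the largest radius.
\<close>

lemma locally_constant_uniform:
  assumes "finite A"
    and "\<And>x. x \<in> subst_points A \<theta> \<Longrightarrow> \<exists>R. \<forall>y\<in>subst_points A \<theta>. agree R x y \<longrightarrow> f y = f x"
  shows "\<exists>R. \<forall>x\<in>subst_points A \<theta>. \<forall>y\<in>subst_points A \<theta>. agree R x y \<longrightarrow> f x = f y"
proof -
  let ?Y = "subst_points A \<theta>"
  obtain r where r: "\<And>x y. x \<in> ?Y \<Longrightarrow> y \<in> ?Y \<Longrightarrow> agree (r x) x y \<Longrightarrow> f y = f x"
    using assms(2) by metis
  define C where "C x = {y \<in> ?Y. agree (r x) x y}" for x
  have "\<forall>U\<in>C ` ?Y. openin (subst_space A \<theta>) U" using openin_cylinder by (auto simp: C_def)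
  moreover have "\<Union> (C ` ?Y) = topspace (subst_space A \<theta>)" by (auto simp: C_def agree_def)
  ultimately obtain F where F: "finite F" "F \<subseteq> C ` ?Y" "\<Union>F = topspace (subst_space A \<theta>)"
    using compact_subst_space[OF assms(1), of \<theta>] unfolding compact_space by meson
  obtain F' where F': "F' \<subseteq> ?Y" "finite F'" "F = C ` F'" using finite_subset_image[OF F(1,2)] by auto
  obtain R where R: "\<forall>m\<in>r ` F'. m \<le> R" using F'(2) finite_nat_set_iff_bounded_le[of "r ` F'"] by auto
  have "f x = f y" if xy: "x \<in> ?Y" "y \<in> ?Y" "agree R x y" for x y
  proof -
    obtain z where z: "z \<in> F'" "x \<in> C z" using F(3) F'(3) xy(1) by auto
    have "r z \<le> R" using R z by simp
    then have "agree (r z) z y" using z(2) xy(3) by (auto simp: C_def agree_def)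
    then show ?thesis using r[of z x] r[of z y] z F' xy by (auto simp: C_def)
  qed
  then show ?thesis by blast
qed

section \<open>Codings of minimal homeomorphisms\<close>

text \<open>
  Integer powers of a bijection of \<open>Y\<close>; negative powers use the inverse of its restriction to \<open>Y\<close>.
\<close>

definition zpow :: "'b set \<Rightarrow> ('b \<Rightarrow> 'b) \<Rightarrow> int \<Rightarrow> 'b \<Rightarrow> 'b" where
  "zpow Y S k x = (if 0 \<le> k then (S ^^ nat k) x else (inv_into Y S ^^ nat (- k)) x)"

lemma zpow_0 [simp]: "zpow Y S 0 x = x" by (simp add: zpow_def)

lemma zpow_int [simp]: "zpow Y S (int n) x = (S ^^ n) x" by (simp add: zpow_def)

locale homeo_system =
  fixes X :: "'b topology" and S :: "'b \<Rightarrow> 'b"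
  assumes homeo: "homeomorphic_map X X S"
begin

abbreviation Y :: "'b set" where "Y \<equiv> topspace X"

abbreviation pw :: "int \<Rightarrow> 'b \<Rightarrow> 'b" where "pw \<equiv> zpow Y S"

lemma S_image: "S ` Y = Y" and S_inj: "inj_on S Y" and S_continuous: "continuous_map X X S"
  using homeo by (auto simp: homeomorphic_eq_everything_map)

lemma S_in: "x \<in> Y \<Longrightarrow> S x \<in> Y" using S_image by blast

lemma inv_in: "x \<in> Y \<Longrightarrow> inv_into Y S x \<in> Y" using S_image by (metis inv_into_into)

lemma S_inv: "x \<in> Y \<Longrightarrow> S (inv_into Y S x) = x" using S_image by (metis f_inv_into_f)

lemma funpow_in: "x \<in> Y \<Longrightarrow> (S ^^ n) x \<in> Y"
  by (induction n) (simp_all add: S_in)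

lemma pw_in: "x \<in> Y \<Longrightarrow> pw k x \<in> Y"
proof -
  assume x: "x \<in> Y"
  have "(inv_into Y S ^^ n) x \<in> Y" for n by (induction n) (simp_all add: x inv_in)
  then show ?thesis using x funpow_in by (simp add: zpow_def)
qed

lemma pw_Suc: assumes "x \<in> Y" shows "pw (k + 1) x = S (pw k x)"
proof (cases "0 \<le> k")
  case True
  then have "nat (k + 1) = Suc (nat k)" by simp
  then show ?thesis using True by (simp add: zpow_def)
next
  case False
  have "pw k x = inv_into Y S (pw (k + 1) x)"
  proof (cases "k = -1")
    case False
    then have "nat (- k) = Suc (nat (- (k + 1)))" using \<open>\<not> 0 \<le> k\<close> by simp
    then show ?thesis using False \<open>\<not> 0 \<le> k\<close> by (simp add: zpow_def)
  qed (simp add: zpow_def)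
  then show ?thesis using S_inv[OF pw_in[OF assms]] by simp
qed

lemma pw_S: assumes "x \<in> Y" shows "pw (k + 1) x = pw k (S x)"
proof (induction k rule: int_induct[where k = 0])
  case base
  show ?case using pw_Suc[OF assms, of 0] by simp
next
  case (step1 k)
  then show ?case using pw_Suc[OF assms, of "k + 1"] pw_Suc[OF S_in[OF assms], of k] by simp
next
  case (step2 k)
  have "S (pw k x) = S (pw (k - 1) (S x))"
    using step2 pw_Suc[OF assms, of k] pw_Suc[OF S_in[OF assms], of "k - 1"] by simp
  then show ?case using S_inj pw_in[OF assms] pw_in[OF S_in[OF assms]] by (simp add: inj_on_eq_iff)
qed

lemma pw_add_nat: assumes "x \<in> Y" shows "pw (i + int q) x = (S ^^ q) (pw i x)"
proof (induction q)
  case (Suc q)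
  have "pw (i + int (Suc q)) x = pw (i + int q + 1) x" by (simp add: algebra_simps)
  then show ?case using pw_Suc[OF assms, of "i + int q"] Suc by simp
qed simp

lemma pw_funpow: "x \<in> Y \<Longrightarrow> pw i ((S ^^ m) x) = pw (i + int m) x"
proof (induction m arbitrary: i)
  case (Suc m)
  then have "pw i ((S ^^ Suc m) x) = pw (i + 1) ((S ^^ m) x)"
    by (simp only: pw_S[OF funpow_in[OF Suc.prems]] funpow.simps comp_apply)
  also have "\<dots> = pw (i + 1 + int m) x" using Suc by blast
  finally show ?case by (simp add: algebra_simps)
qed simp

lemma continuous_funpow: "continuous_map X X f \<Longrightarrow> continuous_map X X (f ^^ n)"
  by (induction n) (auto intro: continuous_map_compose simp: id_def)

lemma continuous_pw: "continuous_map X X (pw k)"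
proof -
  obtain g where g: "homeomorphic_maps X X S g" using homeo homeomorphic_map_maps by blast
  have "continuous_map X X (inv_into Y S)"
  proof (rule continuous_map_eq)
    show "continuous_map X X g" using g by (simp add: homeomorphic_maps_def)
    fix x assume x: "x \<in> Y"
    then have "g x \<in> Y" "S (g x) = x" using g by (auto simp: homeomorphic_maps_def continuous_map_def)
    then show "g x = inv_into Y S x" using S_inj by (metis inv_into_f_f)
  qed
  then show ?thesis
    using continuous_funpow[of "inv_into Y S" "nat (- k)"] continuous_funpow[OF S_continuous, of "nat k"]
    unfolding zpow_def by (cases "0 \<le> k") simp_all
qed

text \<open>
  Every two-sided orbit meets \<open>V\<close>, so by compactness finitely many preimages of \<open>V\<close> under integer powers
  cover the space, with exponents between \<open>-n\<close> and \<open>n\<close>, say.  Applied to \<open>S\<^sup>n x\<close> this gives a visit of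
  the forward orbit of \<open>x\<close> within \<open>2n\<close> steps.
\<close>

lemma minimal_returns:
  assumes "compact_space X" "\<And>x. x \<in> Y \<Longrightarrow> X closure_of (full_orbit Y S x) = Y"
    and V: "openin X V" "V \<noteq> {}"
  shows "\<exists>N. \<forall>x\<in>Y. \<exists>u<N. (S ^^ u) x \<in> V"
proof -
  have "\<exists>k. pw k x \<in> V" if "x \<in> Y" for x
  proof -
    have "full_orbit Y S x \<inter> V \<noteq> {}" using assms(2)[OF that] V unfolding dense_intersects_open by blast
    then obtain y where y: "y \<in> V" "y \<in> full_orbit Y S x" by blast
    then consider n where "y = (S ^^ n) x" | n where "y = (inv_into Y S ^^ n) x"
      unfolding full_orbit_def by blast
    then show ?thesis
    proof cases
      case 1
      then show ?thesis using y by (intro exI[of _ "int n"]) simp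
    next
      case 2
      then have "y = pw (- int n) x" by (cases "n = 0") (simp_all add: zpow_def)
      then show ?thesis using y by blast
    qed
  qed
  define U where "U k = {x \<in> Y. pw k x \<in> V}" for k
  have "\<forall>W\<in>range U. openin X W"
    unfolding U_def using openin_continuous_map_preimage[OF continuous_pw V(1)] by blast
  moreover have "\<Union> (range U) = Y" using \<open>\<And>x. x \<in> Y \<Longrightarrow> \<exists>k. pw k x \<in> V\<close> by (auto simp: U_def)
  ultimately obtain F where F: "finite F" "F \<subseteq> range U" "\<Union>F = Y"
    using assms(1) unfolding compact_space by meson
  obtain K where K: "finite K" "F = U ` K" using finite_subset_image[OF F(1,2)] by auto
  obtain n where n: "\<forall>m\<in>(\<lambda>k. nat \<bar>k\<bar>) ` K. m \<le> n"
    using K(1) finite_nat_set_iff_bounded_le[of "(\<lambda>k. nat \<bar>k\<bar>) ` K"] by auto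
  have "\<exists>u<2 * n + 1. (S ^^ u) x \<in> V" if x: "x \<in> Y" for x
  proof -
    have "(S ^^ n) x \<in> \<Union>F" using F(3) funpow_in[OF x] by simp
    then obtain k where k: "k \<in> K" "pw k ((S ^^ n) x) \<in> V" using K(2) by (auto simp: U_def)
    have kn: "\<bar>k\<bar> \<le> int n" using n k(1) by auto
    then have "pw k ((S ^^ n) x) = (S ^^ nat (k + int n)) x"
      using pw_funpow[OF x, of k n] by (simp add: zpow_def)
    then show ?thesis using k kn by (intro exI[of _ "nat (k + int n)"]) auto
  qed
  then show ?thesis by blast
qed

text \<open>
  The conjugacy sends \<open>x\<close> to its itinerary \<open>k \<mapsto> Q (S\<^sup>k x)\<close>.  The orbit of \<open>x0\<close> visits every nonempty
  open set, hence follows each finite itinerary, so all itineraries belong to the substitution space.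
  Conversely, each finite word of a point of that space is followed by some point of the orbit of
  \<open>x0\<close>, and compactness yields a point that follows the whole sequence.
\<close>

theorem self_similar_coding_conjugacy:
  fixes Q :: "'b \<Rightarrow> 'c"
  assumes compact: "compact_space X"
    and returns: "\<And>V. openin X V \<Longrightarrow> V \<noteq> {} \<Longrightarrow> \<exists>N. \<forall>x\<in>Y. \<exists>u<N. (S ^^ u) x \<in> V"
    and Q_continuous: "continuous_map X (discrete_topology UNIV) Q"
    and separates: "\<And>x y. x \<in> Y \<Longrightarrow> y \<in> Y \<Longrightarrow> (\<And>k. Q (pw k x) = Q (pw k y)) \<Longrightarrow> x = y"
    and x0: "x0 \<in> Y" and fin: "finite (Q ` Y)"
    and G: "G 0 = 0" "\<And>t. G t + 2 \<le> G (Suc t)"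
    and similar: "\<And>t t'. Q ((S ^^ t) x0) = Q ((S ^^ t') x0) \<Longrightarrow>
       map (\<lambda>t. Q ((S ^^ t) x0)) [G t..<G (Suc t)] = map (\<lambda>t. Q ((S ^^ t) x0)) [G t'..<G (Suc t')]"
  shows "\<exists>(B :: 'c set) \<tau>. substitution B \<tau> \<and> primitive_subst B \<tau> \<and> conjugate_systems X S (subst_space B \<tau>) shift"
proof -
  define \<zeta> where "\<zeta> t = Q ((S ^^ t) x0)" for t
  have open_Q: "openin X {x \<in> Y. Q (pw k x) = b}" for k b
  proof -
    have "continuous_map X (discrete_topology UNIV) (Q \<circ> pw k)"
      by (rule continuous_map_compose[OF continuous_pw Q_continuous])
    from openin_continuous_map_preimage[OF this, of "{b}"] show ?thesis by simp
  qed
  have open_word: "openin X {x \<in> Y. \<forall>q<N. Q ((S ^^ q) x) = w q}" for N w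
  proof (induction N)
    case (Suc N)
    have "{x \<in> Y. \<forall>q<Suc N. Q ((S ^^ q) x) = w q}
        = {x \<in> Y. \<forall>q<N. Q ((S ^^ q) x) = w q} \<inter> {x \<in> Y. Q (pw (int N) x) = w N}"
      by (auto simp: less_Suc_eq)
    then show ?case using Suc open_Q[of "int N" "w N"] by (simp only: openin_Int)
  qed simp
  interpret self_similar \<zeta> G
  proof
    show "finite (range \<zeta>)"
      by (rule finite_subset[OF _ fin]) (auto simp: \<zeta>_def funpow_in[OF x0])
    show "G 0 = 0" "G t + 2 \<le> G (Suc t)" for t by (rule G)+
    show "map \<zeta> [G t..<G (Suc t)] = map \<zeta> [G t'..<G (Suc t')]" if "\<zeta> t = \<zeta> t'" for t t'
      using similar[of t t'] that unfolding \<zeta>_def[abs_def] by blast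
    fix t0
    have "openin X {x \<in> Y. Q x = \<zeta> t0}" using open_Q[of 0 "\<zeta> t0"] by simp
    moreover have "{x \<in> Y. Q x = \<zeta> t0} \<noteq> {}" using funpow_in[OF x0, of t0] by (auto simp: \<zeta>_def)
    ultimately obtain N where N: "\<And>x. x \<in> Y \<Longrightarrow> \<exists>u<N. (S ^^ u) x \<in> {x \<in> Y. Q x = \<zeta> t0}"
      using returns by meson
    show "\<exists>N. \<forall>t. \<exists>u. t \<le> u \<and> u < t + N \<and> \<zeta> u = \<zeta> t0"
    proof (rule exI[of _ N], rule allI)
      fix t
      obtain u where u: "u < N" "Q ((S ^^ u) ((S ^^ t) x0)) = \<zeta> t0" using N[OF funpow_in[OF x0, of t]] by blast
      then have "\<zeta> (u + t) = \<zeta> t0" by (simp add: \<zeta>_def funpow_add)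
      then show "\<exists>u. t \<le> u \<and> u < t + N \<and> \<zeta> u = \<zeta> t0" using u by (intro exI[of _ "u + t"]) simp
    qed
  qed
  define h where "h x = (\<lambda>k. Q (pw k x))" for x
  let ?Z = "subst_points (range \<zeta>) \<tau>"
  have h_in: "h x \<in> ?Z" if x: "x \<in> Y" for x
    unfolding points
  proof (intro CollectI allI)
    fix i N
    let ?V = "{y \<in> Y. \<forall>q<N. Q ((S ^^ q) y) = h x (i + int q)}"
    have "pw i x \<in> ?V" using pw_in[OF x] pw_add_nat[OF x] by (simp add: h_def)
    then have "?V \<noteq> {}" by (metis empty_iff)
    note returns[OF open_word[of N "\<lambda>q. h x (i + int q)"] this]
    then obtain N' where "\<forall>x\<in>Y. \<exists>u<N'. (S ^^ u) x \<in> ?V" by (elim exE)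
    then obtain u where u: "(S ^^ u) x0 \<in> ?V" using x0 by (elim ballE exE conjE) auto
    have "h x (i + int q) = \<zeta> (u + q)" if "q < N" for q
    proof -
      have "(S ^^ q) ((S ^^ u) x0) = (S ^^ (u + q)) x0" by (metis add.commute comp_apply funpow_add)
      moreover have "Q ((S ^^ q) ((S ^^ u) x0)) = h x (i + int q)" using u that by blast
      ultimately show ?thesis by (simp add: \<zeta>_def)
    qed
    then show "\<exists>c. \<forall>q<N. h x (i + int q) = \<zeta> (c + q)" by blast
  qed
  have onto: "\<exists>x\<in>Y. h x = y" if y: "y \<in> ?Z" for y
  proof -
    define C where "C K = {x \<in> Y. \<forall>i. \<bar>i\<bar> \<le> int K \<longrightarrow> Q (pw i x) = y i}" for K :: nat
    have "closedin X (C K)" for K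
    proof -
      have "C K = (\<Inter>i\<in>{i. \<bar>i\<bar> \<le> int K}. {x \<in> Y. Q (pw i x) = y i})"
      proof (intro set_eqI iffI)
        fix x assume x: "x \<in> (\<Inter>i\<in>{i. \<bar>i\<bar> \<le> int K}. {x \<in> Y. Q (pw i x) = y i})"
        then have "x \<in> {x \<in> Y. Q (pw 0 x) = y 0}" by (rule INT_D) simp
        then show "x \<in> C K" using x by (simp add: C_def)
      qed (simp add: C_def)
      moreover have "closedin X {x \<in> Y. Q (pw i x) = y i}" for i
      proof -
        have "continuous_map X (discrete_topology UNIV) (Q \<circ> pw i)"
          by (rule continuous_map_compose[OF continuous_pw Q_continuous])
        from closedin_continuous_map_preimage[OF this, of "{y i}"] show ?thesis by simp
      qed
      moreover have "{i. \<bar>i\<bar> \<le> int K} \<noteq> {}" by (auto intro: exI[of _ 0])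
      ultimately show ?thesis by (simp add: closedin_INT)
    qed
    moreover have "C K \<noteq> {}" for K
    proof -
      obtain c where c: "\<And>q. q < 2 * K + 1 \<Longrightarrow> y (- int K + int q) = \<zeta> (c + q)"
        using y unfolding points by blast
      have "Q (pw i ((S ^^ (c + K)) x0)) = y i" if i: "\<bar>i\<bar> \<le> int K" for i
      proof -
        define q where "q = nat (i + int K)"
        have q: "int q = i + int K" "q < 2 * K + 1" using i by (auto simp: q_def)
        have "i + int (c + K) = int (c + q)" using q by simp
        then have "pw i ((S ^^ (c + K)) x0) = (S ^^ (c + q)) x0"
          by (simp only: pw_funpow[OF x0] zpow_int)
        then show ?thesis using c[OF q(2)] q(1) by (simp add: \<zeta>_def)
      qed
      then have "(S ^^ (c + K)) x0 \<in> C K" using funpow_in[OF x0] by (simp add: C_def)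
      then show ?thesis by blast
    qed
    moreover have "decseq C" unfolding decseq_def C_def by force
    ultimately have "(\<Inter>K. C K) \<noteq> {}" using compact by (intro compact_space_imp_nest)
    then obtain x where x: "\<And>K. x \<in> C K" by blast
    have "h x i = y i" for i using x[of "nat \<bar>i\<bar>"] by (simp add: C_def h_def)
    then show ?thesis using x[of 0] by (auto simp: C_def)
  qed
  have cont: "continuous_map X (subst_space (range \<zeta>) \<tau>) h"
  proof (rule continuous_into_subst_space)
    show "continuous_map X (discrete_topology UNIV) (\<lambda>x. h x i)" for i
      using continuous_map_compose[OF continuous_pw Q_continuous, of i] by (simp add: h_def o_def)
  qed (rule h_in)
  have "homeomorphic_map X (subst_space (range \<zeta>) \<tau>) h"
  proof (rule continuous_imp_homeomorphic_map[OF cont compact Hausdorff_subst_space])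
    show "h ` Y = topspace (subst_space (range \<zeta>) \<tau>)" using h_in onto by auto
    show "inj_on h Y" unfolding h_def by (rule inj_onI) (metis separates)
  qed
  moreover have "h (S x) = shift (h x)" if "x \<in> Y" for x
    using pw_S[OF that] by (simp add: h_def shift_def)
  ultimately show ?thesis using substitution primitive unfolding conjugate_systems_def by blast
qed

end

section \<open>Passing to a power of the substitution\<close>

lemma set_iter_word_mono:
  assumes "a \<in> set w" shows "set (subst_iter \<theta> n a) \<subseteq> set ((subst_word \<theta> ^^ n) w)"
  using assms by (auto simp: iter_word_concat)

lemma subst_iter_add: "subst_iter \<theta> (m + n) a = (subst_word \<theta> ^^ m) (subst_iter \<theta> n a)"
  by (simp add: subst_iter_def iter_word_add)

lemma iterate_of_power: "subst_iter (subst_iter \<theta> \<kappa>) m a = subst_iter \<theta> (\<kappa> * m) a"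
proof -
  have "subst_word (subst_iter \<theta> \<kappa>) = subst_word \<theta> ^^ \<kappa>"
    by (rule ext) (simp add: iter_word_concat subst_word_def[of "subst_iter \<theta> \<kappa>"])
  then show ?thesis by (simp add: subst_iter_def[of "subst_iter \<theta> \<kappa>"] subst_iter_def[of \<theta>] funpow_mult)
qed

text \<open>
  Since \<open>\<theta>\<^sup>k(a)\<close> contains \<open>l\<close> for all large \<open>k\<close>, every letter occurs in \<open>\<theta>\<^sup>k(a)\<close> for all large \<open>k\<close>,
  not only for some \<open>k\<close> depending on the letters.  The languages of \<open>\<theta>\<close> and of its power agree: \<open>\<theta>\<^sup>k(a)\<close>
  is part of \<open>\<theta>\<^sup>k\<^sup>+\<^sup>q(l)\<close> for all large \<open>q\<close>, and \<open>k + q\<close> can be chosen as a multiple of the power.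
\<close>

lemma positive_power:
  assumes sub: "substitution A \<theta>" and propr: "proper_subst A \<theta>" and prim: "primitive_subst A \<theta>"
  shows "\<exists>\<kappa> l r. positive_subst A (subst_iter \<theta> \<kappa>) l r \<and> subst_points A (subst_iter \<theta> \<kappa>) = subst_points A \<theta>"
proof -
  obtain l r k0 where l: "l \<in> A" "r \<in> A"
    and pr: "\<And>a. a \<in> A \<Longrightarrow> prefix [l] (subst_iter \<theta> k0 a) \<and> suffix [r] (subst_iter \<theta> k0 a)"
    using propr unfolding proper_subst_def by blast
  have fin: "finite A" using sub by (simp add: substitution_def)
  have inA: "set (subst_iter \<theta> n a) \<subseteq> A" if "a \<in> A" for n a
    using subst_iter_in_lists[OF sub, of "[a]" n] that by (auto simp: subst_iter_def)
  have grow: "filterlim (\<lambda>k. length (subst_iter \<theta> k a)) at_top sequentially" if "a \<in> A" for a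
    using prim that by (simp add: primitive_subst_def)
  have ne: "subst_iter \<theta> n a \<noteq> []" if a: "a \<in> A" for n a
  proof
    assume e: "subst_iter \<theta> n a = []"
    have "eventually (\<lambda>k. 1 \<le> length (subst_iter \<theta> k a)) sequentially"
      using grow[OF a] unfolding filterlim_at_top by blast
    then obtain N where N: "\<And>k. k \<ge> N \<Longrightarrow> 1 \<le> length (subst_iter \<theta> k a)"
      unfolding eventually_sequentially by blast
    have "subst_iter \<theta> (N + n) a = []" unfolding subst_iter_add e by (rule iter_word_Nil)
    then show False using N[of "N + n"] by simp
  qed
  have ends: "(\<exists>u. subst_iter \<theta> k a = l # u) \<and> (\<exists>u. subst_iter \<theta> k a = u @ [r])"
    if k: "k \<ge> k0" and a: "a \<in> A" for k a
  proof -
    define w where "w = subst_iter \<theta> (k - k0) a"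
    have w: "w \<noteq> []" "set w \<subseteq> A" using ne[OF a] inA[OF a] by (simp_all add: w_def)
    have kw: "subst_iter \<theta> k a = (subst_word \<theta> ^^ k0) w"
      using subst_iter_add[of \<theta> k0 "k - k0" a] k by (simp add: w_def)
    obtain b v where bv: "w = b # v" using w by (cases w) auto
    obtain u where u: "subst_iter \<theta> k0 b = l # u" using pr[of b] w bv by (auto simp: prefix_def)
    have 1: "subst_iter \<theta> k a = l # (u @ (subst_word \<theta> ^^ k0) v)"
      unfolding kw bv using u by (simp add: iter_word_concat)
    obtain v' b' where bv': "w = v' @ [b']" using w by (cases w rule: rev_cases) auto
    obtain u' where u': "subst_iter \<theta> k0 b' = u' @ [r]" using pr[of b'] w bv' by (auto simp: suffix_def)
    have "subst_iter \<theta> k a = ((subst_word \<theta> ^^ k0) v' @ u') @ [r]"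
      unfolding kw bv' using u' by (simp add: iter_word_concat)
    then show ?thesis using 1 by blast
  qed
  have "\<exists>kb. \<forall>b\<in>A. b \<in> set (subst_iter \<theta> (kb b) l)"
    using prim l unfolding primitive_subst_def by (intro bchoice) blast
  then obtain kb where kb: "\<And>b. b \<in> A \<Longrightarrow> b \<in> set (subst_iter \<theta> (kb b) l)" by blast
  define q0 where "q0 = k0 + Max (kb ` A)"
  have pos: "b \<in> set (subst_iter \<theta> q a)" if q: "q \<ge> q0" and ab: "a \<in> A" "b \<in> A" for q a b
  proof -
    have "kb b \<le> Max (kb ` A)" using fin ab by simp
    then have m: "q = kb b + (q - kb b)" "q - kb b \<ge> k0" using q by (simp_all add: q0_def)
    have "l \<in> set (subst_iter \<theta> (q - kb b) a)" using ends[OF m(2) ab(1)] by auto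
    then have "set (subst_iter \<theta> (kb b) l) \<subseteq> set (subst_iter \<theta> q a)"
      using set_iter_word_mono subst_iter_add m(1) by metis
    then show ?thesis using kb[OF ab(2)] by blast
  qed
  have "eventually (\<lambda>k. \<forall>a\<in>A. 2 \<le> length (subst_iter \<theta> k a)) sequentially"
    using grow unfolding filterlim_at_top by (intro eventually_ball_finite[OF fin]) blast
  then obtain n2 where n2: "\<And>k a. k \<ge> n2 \<Longrightarrow> a \<in> A \<Longrightarrow> 2 \<le> length (subst_iter \<theta> k a)"
    unfolding eventually_sequentially by blast
  define \<kappa> where "\<kappa> = k0 + q0 + n2 + 1"
  have "positive_subst A (subst_iter \<theta> \<kappa>) l r"
  proof
    fix a assume a: "a \<in> A"
    show "set (subst_iter \<theta> \<kappa> a) = A" using inA[OF a, of \<kappa>] pos[of \<kappa> a] a by (auto simp: \<kappa>_def)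
    show "2 \<le> length (subst_iter \<theta> \<kappa> a)" by (rule n2) (use a in \<open>auto simp: \<kappa>_def\<close>)
    show "\<exists>u. subst_iter \<theta> \<kappa> a = l # u" "\<exists>u. subst_iter \<theta> \<kappa> a = u @ [r]"
      using ends[of \<kappa> a] a by (simp_all add: \<kappa>_def)
  qed (use fin l in auto)
  moreover have "subst_points A (subst_iter \<theta> \<kappa>) = subst_points A \<theta>"
  proof -
    have "(\<exists>k. \<exists>a\<in>A. sublist w (subst_iter (subst_iter \<theta> \<kappa>) k a)) \<longleftrightarrow> (\<exists>k. \<exists>a\<in>A. sublist w (subst_iter \<theta> k a))" for w
    proof
      assume "\<exists>k. \<exists>a\<in>A. sublist w (subst_iter \<theta> k a)"
      then obtain k a where ka: "a \<in> A" "sublist w (subst_iter \<theta> k a)" by blast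
      \<comment> \<open>any \<open>q \<ge> q0\<close> for which \<open>\<kappa>\<close> divides \<open>k + q\<close> would do\<close>
      define q where "q = \<kappa> * (k + q0 + 1) - k"
      have "1 * (k + q0 + 1) \<le> \<kappa> * (k + q0 + 1)" by (rule mult_le_mono1) (simp add: \<kappa>_def)
      then have q: "k + q = \<kappa> * (k + q0 + 1)" "q \<ge> q0" by (simp_all add: q_def)
      have "a \<in> set (subst_iter \<theta> q l)" using pos q l ka by blast
      then have "sublist [a] (subst_iter \<theta> q l)"
        by (metis append_Cons append_Nil in_set_conv_decomp sublist_appendI)
      then have "sublist (subst_iter \<theta> k a) (subst_iter \<theta> (k + q) l)"
        unfolding subst_iter_add by (simp only: subst_iter_def sublist_iter_word)
      then have "sublist w (subst_iter (subst_iter \<theta> \<kappa>) (k + q0 + 1) l)"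
        using ka(2) unfolding iterate_of_power q(1) by (rule sublist_order.order_trans[rotated])
      then show "\<exists>k. \<exists>a\<in>A. sublist w (subst_iter (subst_iter \<theta> \<kappa>) k a)" using l by blast
    qed (auto simp: iterate_of_power)
    then show ?thesis unfolding subst_points_def by simp
  qed
  ultimately show ?thesis by blast
qed

section \<open>A base point and the floors of the towers\<close>

context positive_subst
begin

text \<open>
  The two-sided fixed point: the limit of \<open>\<theta>\<^sup>n(r)\<close>, read to the left, followed by \<open>om\<close>.  Entry \<open>-m\<close> is
  entry \<open>m - 1\<close> of the reversed word \<open>\<theta>\<^sup>m(r)\<close>.
\<close>

definition fixed_point :: "int \<Rightarrow> 'a" where
  "fixed_point i = (if 0 \<le> i then om (nat i) else rev (it (nat (- i)) [r]) ! (nat (- i) - 1))"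

lemma fixed_point_int [simp]: "fixed_point (int k) = om k" by (simp add: fixed_point_def)

lemma rev_it_r_nth:
  assumes "i < length (it m [r])" "i < length (it n [r])"
  shows "rev (it m [r]) ! i = rev (it n [r]) ! i"
proof -
  obtain u u' where "it (m + n) [r] = u @ it m [r]" "it (n + m) [r] = u' @ it n [r]"
    using it_r_extends by meson
  then have "rev (it m [r]) @ rev u = rev (it n [r]) @ rev u'" by (metis add.commute rev_append)
  then have "(rev (it m [r]) @ rev u) ! i = (rev (it n [r]) @ rev u') ! i" by simp
  then show ?thesis using assms by (simp add: nth_append)
qed

lemma fixed_point_window:
  assumes "- int (length (it n [r])) \<le> i" "i < int (length (it n [l]))"
  shows "fixed_point i = (it n [r] @ it n [l]) ! nat (i + int (length (it n [r])))"
proof (cases "0 \<le> i")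
  case True
  then have "nat (i + int (length (it n [r]))) = length (it n [r]) + nat i" by simp
  then show ?thesis using True assms it_l_nth[of "nat i" n] by (simp add: fixed_point_def nth_append)
next
  case False
  define m where "m = nat (- i)"
  have m: "0 < m" "m \<le> length (it n [r])" "i = - int m" using False assms by (simp_all add: m_def)
  have "fixed_point i = rev (it m [r]) ! (m - 1)" using False by (simp add: fixed_point_def m_def)
  also have "\<dots> = rev (it n [r]) ! (m - 1)"
    by (rule rev_it_r_nth) (use m length_it_letter_gt[OF r_in, of m] in simp_all)
  also have "\<dots> = it n [r] ! (length (it n [r]) - m)" using m by (simp add: rev_nth)
  also have "\<dots> = (it n [r] @ it n [l]) ! nat (i + int (length (it n [r])))"
  proof -
    have "nat (i + int (length (it n [r]))) = length (it n [r]) - m" using m by linarith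
    moreover have "length (it n [r]) - m < length (it n [r])" using m by linarith
    ultimately show ?thesis by (simp add: nth_append)
  qed
  finally show ?thesis .
qed

text \<open>
  The word \<open>rl\<close> occurs in \<open>\<theta>\<^sup>2(l)\<close>, across the boundary of the images of the first two letters of \<open>\<theta>(l)\<close>,
  and hence \<open>\<theta>\<^sup>n(r)\<theta>\<^sup>n(l)\<close> occurs in \<open>\<theta>\<^sup>n\<^sup>+\<^sup>2(l)\<close>.
\<close>

lemma fixed_point_in: "fixed_point \<in> subst_points A \<theta>"
proof -
  obtain b c w where bc: "\<theta> l = b # c # w"
    using length_image[OF l_in] by (metis Suc_le_length_iff numeral_2_eq_2)
  have "b \<in> A" "c \<in> A" using set_image[OF l_in] bc by auto
  then obtain u v where uv: "\<theta> b = u @ [r]" "\<theta> c = l # v" using image_starts image_ends by blast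
  have "it 2 [l] = u @ [r, l] @ (v @ subst_word \<theta> w)"
    by (simp add: numeral_2_eq_2 subst_word_def bc uv)
  then have "sublist ([r] @ [l]) (it 2 [l])" by (metis append_Cons append_Nil sublist_appendI)
  then have rl: "sublist (it n [r] @ it n [l]) (it (n + 2) [l])" for n
    unfolding iter_word_add iter_word_append[symmetric] by (rule sublist_iter_word)
  have word: "sublist (map fixed_point [i..j]) (it (nat (max \<bar>i\<bar> \<bar>j\<bar>) + 2) [l])" if ij: "i \<le> j" for i j
  proof -
    define n where "n = nat (max \<bar>i\<bar> \<bar>j\<bar>)"
    have n: "n < length (it n [r])" "n < length (it n [l])" using length_it_letter_gt l_in r_in by auto
    have ijn: "- int n \<le> i" "j \<le> int n" by (auto simp: n_def)
    have "sublist (map fixed_point [i..j]) (it n [r] @ it n [l])"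
    proof (rule sublist_of_nth_offset[where c = "nat (i + int (length (it n [r])))"])
      show "nat (i + int (length (it n [r]))) + length (map fixed_point [i..j]) \<le> length (it n [r] @ it n [l])"
        using ij n ijn by simp
      show "\<forall>q<length (map fixed_point [i..j]). map fixed_point [i..j] ! q
        = (it n [r] @ it n [l]) ! (nat (i + int (length (it n [r]))) + q)"
      proof (intro allI impI)
        fix q assume "q < length (map fixed_point [i..j])"
        then have q: "i + int q \<le> j" by simp
        have "fixed_point (i + int q) = (it n [r] @ it n [l]) ! nat (i + int q + int (length (it n [r])))"
          by (rule fixed_point_window) (use n ijn q in linarith)+
        moreover have "nat (i + int q + int (length (it n [r]))) = nat (i + int (length (it n [r]))) + q"
          using n ijn by simp
        ultimately show "map fixed_point [i..j] ! q
          = (it n [r] @ it n [l]) ! (nat (i + int (length (it n [r]))) + q)" using q by (simp add: nth_upto)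
      qed
    qed
    then show ?thesis using rl[of n] unfolding n_def by (rule sublist_order.order_trans)
  qed
  have "fixed_point i \<in> A" for i
  proof -
    have "set (map fixed_point [i..i]) \<subseteq> set (it (nat (max \<bar>i\<bar> \<bar>i\<bar>) + 2) [l])"
      using word[of i i] by (intro set_mono_sublist) simp
    moreover have "set (it (nat (max \<bar>i\<bar> \<bar>i\<bar>) + 2) [l]) \<subseteq> A"
      by (rule set_it) (simp add: l_in)
    moreover have "fixed_point i \<in> set (map fixed_point [i..i])" by simp
    ultimately show ?thesis by blast
  qed
  then show ?thesis using word l_in less_imp_le unfolding subst_points_def subst_iter_def by blast
qed

lemma points_occur_in_om:
  assumes "x \<in> subst_points A \<theta>"
  shows "\<exists>c. \<forall>q<N. x (i + int q) = om (c + q)"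
proof -
  have "i < i + int (Suc N)" by simp
  then obtain k a where ka: "a \<in> A" "sublist (map x [i..i + int (Suc N)]) (subst_iter \<theta> k a)"
    using assms unfolding subst_points_def by blast
  obtain c where c: "\<And>q. q < length (map x [i..i + int (Suc N)]) \<Longrightarrow> map x [i..i + int (Suc N)] ! q = om (c + q)"
    using language_occurs_in_om[OF ka(2,1)] by blast
  have "x (i + int q) = om (c + q)" if "q < N" for q
    using c[of q] that by (simp add: nth_upto)
  then show ?thesis by blast
qed

text \<open>
  Cuts and floors of an arbitrary point, seen from its coordinate \<open>0\<close>; on the forward orbit of
  \<open>fixed_point\<close> under the shift they agree with \<open>cut\<close> and \<open>floor_at\<close> (\<open>floor_pt_fixed_point\<close>).
\<close>

definition occ :: "nat \<Rightarrow> (int \<Rightarrow> 'a) \<Rightarrow> int \<Rightarrow> bool" where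
  "occ n x j \<longleftrightarrow> (\<forall>i<vlen n. x (j + int i) = om i)"

definition behind_pt :: "nat \<Rightarrow> (int \<Rightarrow> 'a) \<Rightarrow> nat" where
  "behind_pt n x = (LEAST m. occ n x (- int m))"

definition ahead_pt :: "nat \<Rightarrow> (int \<Rightarrow> 'a) \<Rightarrow> nat" where
  "ahead_pt n x = (LEAST k. 0 < k \<and> occ n x (int k))"

definition floor_pt :: "nat \<Rightarrow> (int \<Rightarrow> 'a) \<Rightarrow> 'a list \<times> nat" where
  "floor_pt n x = (map (\<lambda>i. x (int i - int (behind_pt n x))) [0..<behind_pt n x + ahead_pt n x], behind_pt n x)"

definition gmax :: "nat \<Rightarrow> nat" where "gmax n = (lmax + 1) * bmax n"

lemma occ_syndetic:
  assumes "x \<in> subst_points A \<theta>" shows "\<exists>m\<le>gmax n. occ n x (j + int m)"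
proof -
  obtain c where c: "\<And>q. q < gmax n + vlen n \<Longrightarrow> x (j + int q) = om (c + q)"
    using points_occur_in_om[OF assms] by blast
  obtain i where i: "cs n i \<le> c" "c < cs n (Suc i)"
    using interval_exists[OF strict_mono_cs, of n c] by auto
  then obtain m where m: "cs n (Suc i) = c + m" using le_Suc_ex less_imp_le by metis
  have mg: "m \<le> gmax n" using cs_gap_le[of n i] i m unfolding gmax_def by linarith
  have "occ n x (j + int m)" unfolding occ_def
  proof (intro allI impI)
    fix q assume q: "q < vlen n"
    have "x (j + int (m + q)) = om (c + (m + q))" using c[of "m + q"] mg q by linarith
    also have "\<dots> = om q" using cut_cs[of n "Suc i"] q by (simp add: cut_def m add.assoc)
    finally show "x (j + int m + int q) = om q" by (simp add: add.assoc)
  qed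
  then show ?thesis using mg by blast
qed

lemma behind_pt:
  assumes "x \<in> subst_points A \<theta>"
  shows "occ n x (- int (behind_pt n x))" "behind_pt n x \<le> gmax n"
proof -
  obtain m where m: "m \<le> gmax n" "occ n x (- int (gmax n) + int m)" using occ_syndetic[OF assms] by blast
  then have "occ n x (- int (gmax n - m))" by (simp add: of_nat_diff algebra_simps)
  then show "occ n x (- int (behind_pt n x))" "behind_pt n x \<le> gmax n"
    unfolding behind_pt_def using LeastI[of "\<lambda>m. occ n x (- int m)"] Least_le[of "\<lambda>m. occ n x (- int m)" "gmax n - m"]
    by auto
qed

lemma ahead_pt:
  assumes "x \<in> subst_points A \<theta>"
  shows "0 < ahead_pt n x" "occ n x (int (ahead_pt n x))" "ahead_pt n x \<le> gmax n + 1"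
proof -
  let ?P = "\<lambda>k. 0 < k \<and> occ n x (int k)"
  obtain m where m: "m \<le> gmax n" "occ n x (1 + int m)" using occ_syndetic[OF assms] by blast
  then have P: "?P (m + 1)" by (simp add: add.commute)
  show "0 < ahead_pt n x" "occ n x (int (ahead_pt n x))"
    unfolding ahead_pt_def using LeastI[of ?P, OF P] by auto
  have "ahead_pt n x \<le> m + 1" unfolding ahead_pt_def by (rule Least_le) (rule P)
  then show "ahead_pt n x \<le> gmax n + 1" using m by simp
qed

lemma floor_pt_local:
  assumes "x \<in> subst_points A \<theta>" "y \<in> subst_points A \<theta>" "agree (gmax n + 1 + vlen n) x y"
  shows "floor_pt n x = floor_pt n y"
proof -
  have ag: "x i = y i" if "\<bar>i\<bar> \<le> int (gmax n + 1 + vlen n)" for i using assms(3) that by (simp only: agree_def)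
  have occ: "occ n x j \<longleftrightarrow> occ n y j" if j: "\<bar>j\<bar> \<le> int (gmax n + 1)" for j
  proof -
    have "x (j + int i) = y (j + int i)" if "i < vlen n" for i by (rule ag) (use j that in linarith)
    then show ?thesis by (simp add: occ_def)
  qed
  have b: "behind_pt n x = behind_pt n y" unfolding behind_pt_def
  proof (rule Least_cong_upto)
    show "occ n x (- int (behind_pt n x))" "behind_pt n x \<le> gmax n" using behind_pt[OF assms(1)] by auto
    show "occ n x (- int i) \<longleftrightarrow> occ n y (- int i)" if "i \<le> gmax n" for i
      by (rule occ) (use that in linarith)
  qed
  have a: "ahead_pt n x = ahead_pt n y" unfolding ahead_pt_def
  proof (rule Least_cong_upto)
    show "0 < ahead_pt n x \<and> occ n x (int (ahead_pt n x))" "ahead_pt n x \<le> gmax n + 1"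
      using ahead_pt[OF assms(1)] by auto
    show "0 < i \<and> occ n x (int i) \<longleftrightarrow> 0 < i \<and> occ n y (int i)" if "i \<le> gmax n + 1" for i
      using occ[of "int i"] that by auto
  qed
  have "x (int i - int (behind_pt n x)) = y (int i - int (behind_pt n x))" if "i < behind_pt n x + ahead_pt n x" for i
    by (rule ag) (use that behind_pt(2)[OF assms(1), of n] ahead_pt(3)[OF assms(1), of n] in linarith)
  then show ?thesis unfolding floor_pt_def b[symmetric] a[symmetric] by simp
qed

lemma finite_floors: "finite (floor_pt n ` subst_points A \<theta>)"
proof (rule finite_subset)
  show "floor_pt n ` subst_points A \<theta> \<subseteq> {w. set w \<subseteq> A \<and> length w \<le> 2 * gmax n + 1} \<times> {..gmax n}"
  proof
    fix z assume "z \<in> floor_pt n ` subst_points A \<theta>"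
    then obtain x where x: "x \<in> subst_points A \<theta>" "z = floor_pt n x" by blast
    show "z \<in> {w. set w \<subseteq> A \<and> length w \<le> 2 * gmax n + 1} \<times> {..gmax n}"
      unfolding x(2) floor_pt_def
      using behind_pt(2)[OF x(1), of n] ahead_pt(3)[OF x(1), of n] subst_points_in[OF x(1)] by auto
  qed
  show "finite ({w. set w \<subseteq> A \<and> length w \<le> 2 * gmax n + 1} \<times> {..gmax n})"
    using finite_lists_length_le[OF finite_A] by simp
qed

text \<open>
  Position \<open>0\<close> of \<open>om\<close> is a cut, so looking back from position \<open>k\<close> never leads to negative coordinates.
\<close>

lemma floor_pt_fixed_point: "floor_pt n (\<lambda>i. fixed_point (i + int k)) = floor_at n k"
proof -
  let ?x = "\<lambda>i. fixed_point (i + int k)"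
  have om: "?x (int i - int b) = om (k - b + i)" if "b \<le> k" for i b
  proof -
    have "int i - int b + int k = int (k - b + i)" using that by simp
    then show ?thesis by (metis fixed_point_int)
  qed
  have occ: "occ n ?x (- int m) \<longleftrightarrow> m \<le> k \<and> cut n (k - m)" if "m \<le> k" for m
    unfolding occ_def cut_def using om[OF that] that by (simp add: algebra_simps)
  have b: "behind_pt n ?x = behind n k" unfolding behind_pt_def behind_def
  proof (rule Least_cong_upto)
    show "occ n ?x (- int k)" using occ[of k] cut_0 by simp
  qed (use occ in auto)
  have "behind n k \<le> k" unfolding behind_def by (rule Least_le) (simp add: cut_0)
  have "occ n ?x (int m) \<longleftrightarrow> cut n (k + m)" for m
    unfolding occ_def cut_def using om[of 0] by (simp add: algebra_simps flip: of_nat_add)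
  then have a: "ahead_pt n ?x = ahead n k" unfolding ahead_pt_def ahead_def by simp
  have "map (\<lambda>i. ?x (int i - int (behind n k))) [0..<behind n k + ahead n k]
     = map om [k - behind n k..<k + ahead n k]"
    using \<open>behind n k \<le> k\<close> by (intro nth_equalityI) (auto simp: om)
  then show ?thesis unfolding floor_pt_def floor_at_def a b by simp
qed

text \<open>
  The floor gives the word up to the next cut, and from there on \<open>\<theta>\<^sup>n(l)\<close> is known.
\<close>

lemma floor_pt_determines:
  assumes "x \<in> subst_points A \<theta>" "y \<in> subst_points A \<theta>" "floor_pt n x = floor_pt n y"
    and i: "0 \<le> i" "i < int (vlen n)"
  shows "x i = y i"
proof -
  have b: "behind_pt n x = behind_pt n y" using assms(3) by (simp add: floor_pt_def)
  have ab: "behind_pt n x + ahead_pt n x = behind_pt n y + ahead_pt n y"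
    using arg_cong[OF assms(3), of "length \<circ> fst"] by (simp add: floor_pt_def)
  then have a: "ahead_pt n x = ahead_pt n y" using b by simp
  show ?thesis
  proof (cases "i < int (ahead_pt n x)")
    case True
    define j where "j = nat i + behind_pt n x"
    have j: "j < behind_pt n x + ahead_pt n x" "int j - int (behind_pt n x) = i" using True i by (simp_all add: j_def)
    have "fst (floor_pt n x) ! j = fst (floor_pt n y) ! j" using assms(3) by simp
    then have "map (\<lambda>i. x (int i - int (behind_pt n x))) [0..<behind_pt n x + ahead_pt n x] ! j
      = map (\<lambda>i. y (int i - int (behind_pt n x))) [0..<behind_pt n x + ahead_pt n x] ! j"
      unfolding floor_pt_def fst_conv a[symmetric] b[symmetric] .
    then show ?thesis using j by simp
  next
    case False
    define j where "j = nat (i - int (ahead_pt n x))"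
    have j: "j < vlen n" "int (ahead_pt n x) + int j = i" using False i by (simp_all add: j_def)
    have "x i = om j" using ahead_pt(2)[OF assms(1), of n] j by (auto simp: occ_def)
    moreover have "y i = om j" using ahead_pt(2)[OF assms(2), of n] j by (auto simp: occ_def a[symmetric])
    ultimately show ?thesis by simp
  qed
qed

end

section \<open>Bounded speedups\<close>

lemma speedup_apply: "speedup p x = (\<lambda>i. x (i + int (p x)))"
  by (simp add: speedup_def shift_pow)

lemma aperiodic_translates_distinct:
  assumes ap: "aperiodic_subst A \<theta>" and x: "x \<in> subst_points A \<theta>"
    and eq: "(\<lambda>i. x (i + a)) = (\<lambda>i. x (i + b))"
  shows "a = (b::int)"
proof -
  have no: "\<not> c < d" if e: "\<And>i. x (i + c) = x (i + d)" for c d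
  proof
    assume "c < d"
    have "(shift ^^ nat (d - c)) x = x"
    proof
      fix i
      have "(shift ^^ nat (d - c)) x i = x ((i - c) + d)" using \<open>c < d\<close> by (simp add: shift_pow algebra_simps)
      also have "\<dots> = x i" using e[of "i - c"] by simp
      finally show "(shift ^^ nat (d - c)) x i = x i" .
    qed
    moreover have "nat (d - c) > 0" using \<open>c < d\<close> by simp
    ultimately show False using ap x unfolding aperiodic_subst_def by blast
  qed
  have e: "x (i + a) = x (i + b)" for i using fun_cong[OF eq, of i] .
  show ?thesis using no[of a b] no[of b a] e by fastforce
qed

text \<open>
  By aperiodicity \<open>p x = n\<close> is the equation \<open>S x = T\<^sup>n x\<close> between continuous maps.  The level sets of
  \<open>p\<close> are thus closed and, being finitely many, open.
\<close>

lemma bounded_time_locally_constant: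
  assumes fin: "finite A" and ap: "aperiodic_subst A \<theta>"
    and bd: "\<And>x. x \<in> subst_points A \<theta> \<Longrightarrow> p x \<le> M"
    and cont: "continuous_map (subst_space A \<theta>) (subst_space A \<theta>) (speedup p)"
  shows "\<exists>R. \<forall>x\<in>subst_points A \<theta>. \<forall>y\<in>subst_points A \<theta>. agree R x y \<longrightarrow> p x = p y"
proof (rule locally_constant_uniform[OF fin])
  let ?Y = "subst_points A \<theta>" and ?X = "subst_space A \<theta>"
  have closed: "closedin ?X {x \<in> ?Y. p x = n}" for n
  proof -
    have "closedin ?X {x \<in> topspace ?X. speedup p x = (\<lambda>i. x (i + int n))}"
      by (rule closedin_continuous_maps_eq[OF Hausdorff_subst_space cont continuous_translate])
    also have "{x \<in> topspace ?X. speedup p x = (\<lambda>i. x (i + int n))} = {x \<in> ?Y. p x = n}"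
      using aperiodic_translates_distinct[OF ap] by (fastforce simp: speedup_apply)
    finally show ?thesis .
  qed
  fix x assume x: "x \<in> ?Y"
  have "closedin ?X (\<Union>n\<in>{..M} - {p x}. {y \<in> ?Y. p y = n})" using closed by (intro closedin_Union) auto
  then have "openin ?X (topspace ?X - (\<Union>n\<in>{..M} - {p x}. {y \<in> ?Y. p y = n}))" by blast
  from open_contains_cylinder[OF this, of x] obtain R where
    "\<forall>y\<in>?Y. agree R x y \<longrightarrow> y \<in> topspace ?X - (\<Union>n\<in>{..M} - {p x}. {y \<in> ?Y. p y = n})"
    using x by auto
  then show "\<exists>R. \<forall>y\<in>?Y. agree R x y \<longrightarrow> p y = p x" using bd by (intro exI[of _ R]) fastforce
qed

context positive_subst
begin

lemma om_aperiodic_of_points: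
  assumes "aperiodic_subst A \<theta>" "\<delta> > 0" shows "\<exists>k. om k \<noteq> om (k + \<delta>)"
proof (rule ccontr)
  assume "\<not> ?thesis"
  then have per: "om k = om (k + \<delta>)" for k by blast
  have "fixed_point (i + 0) = fixed_point (i + int \<delta>)" for i
  proof -
    obtain c where c: "\<forall>q<Suc \<delta>. fixed_point (i + int q) = om (c + q)"
      using points_occur_in_om[OF fixed_point_in] by blast
    have "fixed_point (i + int 0) = om (c + 0)" "fixed_point (i + int \<delta>) = om (c + \<delta>)"
      using c by blast+
    then show ?thesis using per[of c] by simp
  qed
  then have "0 = int \<delta>" by (intro aperiodic_translates_distinct[OF assms(1) fixed_point_in]) blast
  then show False using assms(2) by simp
qed

text \<open>
  Let \<open>p x\<close> depend on the coordinates of \<open>x\<close> between \<open>-R\<close> and \<open>R\<close>.  The point \<open>T\<^sup>k x0\<close>, where \<open>x0\<close> is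
  the two-sided fixed point, reveals only its coordinates from \<open>-k\<close> on as part of \<open>om\<close>; therefore jumps
  at position \<open>k\<close> of \<open>om\<close> are defined by \<open>T\<^sup>k\<^sup>+\<^sup>R x0\<close>, and points are coded by the floors of \<open>T\<^sup>-\<^sup>R x\<close>.
  Equal codes of \<open>x\<close> and \<open>y\<close> force \<open>p x = p y\<close> and equality of the coordinates from \<open>0\<close> to \<open>p x\<close>, so
  equal itineraries force \<open>x = y\<close>.
\<close>

theorem speedup_is_substitution_system:
  fixes p :: "(int \<Rightarrow> 'a) \<Rightarrow> nat"
  assumes ap: "aperiodic_subst A \<theta>"
    and pos: "\<And>x. x \<in> subst_points A \<theta> \<Longrightarrow> p x > 0"
    and bd: "\<And>x. x \<in> subst_points A \<theta> \<Longrightarrow> p x \<le> M"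
    and minimal: "minimal_homeo (subst_space A \<theta>) (speedup p)"
  shows "\<exists>(B :: nat set) \<tau>. substitution B \<tau> \<and> primitive_subst B \<tau> \<and>
           conjugate_systems (subst_space A \<theta>) (speedup p) (subst_space B \<tau>) shift"
proof -
  let ?X = "subst_space A \<theta>" and ?Y = "subst_points A \<theta>" and ?S = "speedup p"
  interpret homeo_system ?X ?S using minimal by unfold_locales (simp add: minimal_homeo_def)
  have S_Y: "?S x \<in> ?Y" if "x \<in> ?Y" for x using S_in[of x] that by simp
  have injS: "inj_on ?S ?Y" using S_inj by simp
  obtain R where R: "\<And>x y. x \<in> ?Y \<Longrightarrow> y \<in> ?Y \<Longrightarrow> agree R x y \<Longrightarrow> p x = p y"
    using bounded_time_locally_constant[OF finite_A ap bd S_continuous] by blast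
  define tr where "tr k = (\<lambda>i. fixed_point (i + k))" for k :: int
  have tr_in: "tr k \<in> ?Y" for k unfolding tr_def by (rule translate_in_subst_points[OF fixed_point_in])
  have tr_inj: "a = b" if "tr a = tr b" for a b
    using aperiodic_translates_distinct[OF ap fixed_point_in] that unfolding tr_def by blast
  define P where "P k = p (tr (int (k + R)))" for k
  \<comment> \<open>\<open>2 * R + 1\<close> coordinates determine a jump; the summand \<open>M\<close> lets a floor determine all coordinates that the jump passes\<close>
  define L where "L = 2 * R + 1 + M"
  have S_tr: "?S (tr (int (k + R))) = tr (int (k + P k + R))" for k
    unfolding speedup_apply P_def[symmetric] by (simp add: tr_def algebra_simps)
  interpret bounded_jumps A \<theta> l r P L M
  proof
    show "\<exists>k. om k \<noteq> om (k + \<delta>)" if "0 < \<delta>" for \<delta> by (rule om_aperiodic_of_points[OF ap that])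
    show "0 < P k" "P k \<le> M" for k unfolding P_def by (simp_all add: pos bd tr_in)
    show "P k = P k'" if om: "\<And>i. i < L \<Longrightarrow> om (k + i) = om (k' + i)" for k k'
      unfolding P_def
    proof (rule R[OF tr_in tr_in])
      have "tr (int (k + R)) i = tr (int (k' + R)) i" if i: "\<bar>i\<bar> \<le> int R" for i
      proof -
        define j where "j = nat (i + int R)"
        have "j < L" "i + int (k + R) = int (k + j)" "i + int (k' + R) = int (k' + j)"
          using i by (simp_all add: j_def L_def)
        then show ?thesis using om[of j] unfolding tr_def by (simp only: fixed_point_int)
      qed
      then show "agree R (tr (int (k + R))) (tr (int (k' + R)))" by (simp add: agree_def)
    qed
    show "inj (\<lambda>k. k + P k)"
    proof (rule injI)
      fix k k' assume "k + P k = k' + P k'"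
      then have "?S (tr (int (k + R))) = ?S (tr (int (k' + R)))" by (simp only: S_tr)
      then have "tr (int (k + R)) = tr (int (k' + R))" using injS tr_in by (simp only: inj_on_eq_iff)
      then show "k = k'" using tr_inj by fastforce
    qed
  qed
  have orbit: "(?S ^^ t) (tr (int R)) = tr (int (orb t + R))" for t
  proof (induction t)
    case (Suc t)
    then show ?case using S_tr[of "orb t"] by (simp add: path_Suc)
  qed simp
  obtain n G where n: "n \<ge> L" and G: "G 0 = 0" "\<And>t. G t + 2 \<le> G (Suc t)"
    and similar: "\<And>t t'. floor_at n (orb t) = floor_at n (orb t') \<Longrightarrow>
        map (\<lambda>t. floor_at n (orb t)) [G t..<G (Suc t)] = map (\<lambda>t. floor_at n (orb t)) [G t'..<G (Suc t')]"
    using self_similar_orbit[of L] by blast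
  have Lv: "L < vlen n" using n vlen_gt[of n] by simp
  define D where "D = floor_pt n ` ?Y"
  obtain enc :: "'a list \<times> nat \<Rightarrow> nat" where enc: "inj_on enc D"
    using finite_imp_inj_to_nat_seg[OF finite_floors[of n]] unfolding D_def by blast
  define back_R where "back_R x = (\<lambda>i. x (i + - int R))" for x :: "int \<Rightarrow> 'a"
  have back_R_in: "back_R x \<in> ?Y" if "x \<in> ?Y" for x
    unfolding back_R_def by (rule translate_in_subst_points[OF that])
  define Q where "Q x = enc (floor_pt n (back_R x))" for x
  have Q_eq: "Q x = Q y \<longleftrightarrow> floor_pt n (back_R x) = floor_pt n (back_R y)" if "x \<in> ?Y" "y \<in> ?Y" for x y
    unfolding Q_def using enc back_R_in that by (simp add: D_def inj_on_eq_iff)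
  have Q_orbit: "Q ((?S ^^ t) (tr (int R))) = enc (floor_at n (orb t))" for t
  proof -
    have "back_R (tr (int (orb t + R))) = (\<lambda>i. fixed_point (i + int (orb t)))"
      by (simp add: back_R_def tr_def)
    then show ?thesis unfolding orbit Q_def by (simp add: floor_pt_fixed_point)
  qed
  have floor_D: "floor_at n (orb t) \<in> D" for t
    using tr_in[of "int (orb t)"] floor_pt_fixed_point[of n "orb t"] unfolding D_def tr_def by (metis image_eqI)
  have near: "x i = y i" if xy: "x \<in> ?Y" "y \<in> ?Y" "Q x = Q y" and i: "- int R \<le> i" "i \<le> int (R + M)" for x y i
  proof -
    have "back_R x (i + int R) = back_R y (i + int R)"
      using Lv i xy by (intro floor_pt_determines[OF back_R_in back_R_in, of _ _ n]) (auto simp: Q_eq L_def)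
    then show ?thesis by (simp add: back_R_def)
  qed
  have same_p: "p x = p y" if xy: "x \<in> ?Y" "y \<in> ?Y" "Q x = Q y" for x y
    using near[OF xy] by (intro R xy) (auto simp: agree_def)
  have future: "x i = y i"
    if "x \<in> ?Y" "y \<in> ?Y" "\<And>k. Q (pw k x) = Q (pw k y)" "0 \<le> i" "i < int m" for x y i m
    using that
  proof (induction m arbitrary: x y i)
    case (Suc m)
    have Qxy: "Q x = Q y" using Suc.prems(3)[of 0] by simp
    have pe: "p x = p y" by (rule same_p) (use Suc.prems Qxy in auto)
    show ?case
    proof (cases "i < int (p x)")
      case True
      then show ?thesis using bd[OF Suc.prems(1)] Suc.prems by (intro near Qxy) auto
    next
      case False
      have "?S x (i - int (p x)) = ?S y (i - int (p x))"
      proof (rule Suc.IH)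
        show "Q (pw k (?S x)) = Q (pw k (?S y))" for k
          using Suc.prems(3)[of "k + 1"] pw_S[of x k] pw_S[of y k] Suc.prems by simp
      qed (use False S_Y Suc.prems pos[OF Suc.prems(1)] in auto)
      then show ?thesis by (simp add: speedup_apply pe)
    qed
  qed simp
  have past: "x i = y i"
    if "x \<in> ?Y" "y \<in> ?Y" "\<And>k. Q (pw k x) = Q (pw k y)" "- int m \<le> i" for x y i m
    using that
  proof (induction m arbitrary: x y i)
    case 0
    then show ?case using future[of x y i "nat (i + 1)"] by simp
  next
    case (Suc m)
    define x' where "x' = pw (-1) x"
    define y' where "y' = pw (-1) y"
    have x': "x' \<in> ?Y" "?S x' = x" and y': "y' \<in> ?Y" "?S y' = y"
      using pw_in[of _ "-1"] pw_Suc[of _ "-1"] Suc.prems by (auto simp: x'_def y'_def)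
    have Q': "Q (pw k x') = Q (pw k y')" for k
      using Suc.prems(3)[of "k - 1"] pw_S[of x' "k - 1"] pw_S[of y' "k - 1"] x' y' by simp
    have "p x' = p y'" by (rule same_p) (use x' y' Q'[of 0] in auto)
    moreover have "x' (i + int (p x')) = y' (i + int (p x'))"
      by (rule Suc.IH) (use x' y' Q' Suc.prems pos[OF x'(1)] in auto)
    ultimately have "?S x' i = ?S y' i" by (simp add: speedup_apply)
    then show ?case using x' y' by simp
  qed
  show ?thesis
  proof (rule self_similar_coding_conjugacy[where Q = Q and ?x0.0 = "tr (int R)" and G = G])
    show compact: "compact_space ?X" by (rule compact_subst_space[OF finite_A])
    show "\<exists>N. \<forall>x\<in>Y. \<exists>u<N. (?S ^^ u) x \<in> V" if "openin ?X V" "V \<noteq> {}" for V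
      using minimal_returns[OF compact _ that] minimal by (simp add: minimal_homeo_def)
    show "continuous_map ?X (discrete_topology UNIV) Q"
    proof (rule continuous_locally_constant)
      fix x y assume xy: "x \<in> ?Y" "y \<in> ?Y" "agree (gmax n + 1 + vlen n + R) x y"
      then have "agree (gmax n + 1 + vlen n) (back_R x) (back_R y)" by (auto simp: agree_def back_R_def)
      then show "Q x = Q y" unfolding Q_def using floor_pt_local[OF back_R_in back_R_in] xy by metis
    qed
    show "x = y" if "x \<in> Y" "y \<in> Y" "\<And>k. Q (pw k x) = Q (pw k y)" for x y
    proof
      fix i show "x i = y i" by (rule past[where m = "nat \<bar>i\<bar>"]) (use that in auto)
    qed
    show "tr (int R) \<in> Y" using tr_in by simp
    have "Q ` Y \<subseteq> enc ` D" using back_R_in by (auto simp: Q_def D_def)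
    then show "finite (Q ` Y)" using finite_floors[of n] finite_subset unfolding D_def by blast
    fix t t' assume "Q ((?S ^^ t) (tr (int R))) = Q ((?S ^^ t') (tr (int R)))"
    then have "floor_at n (orb t) = floor_at n (orb t')"
      using enc floor_D unfolding Q_orbit by (simp add: inj_on_eq_iff)
    from arg_cong[OF similar[OF this], of "map enc"]
    show "map (\<lambda>t. Q ((?S ^^ t) (tr (int R)))) [G t..<G (Suc t)]
        = map (\<lambda>t. Q ((?S ^^ t) (tr (int R)))) [G t'..<G (Suc t')]"
      unfolding Q_orbit by (simp add: o_def)
  qed (rule G)+
qed

end

theorem theorem4p18:
  fixes A :: "'a set" and \<theta> :: "'a \<Rightarrow> 'a list"
    and p :: "(int \<Rightarrow> 'a) \<Rightarrow> nat"
  assumes "substitution A \<theta>"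
    and "proper_subst A \<theta>"
    and "primitive_subst A \<theta>"
    and "aperiodic_subst A \<theta>"
    and "\<forall>x\<in>subst_points A \<theta>. p x > 0"
    and "\<exists>M. \<forall>x\<in>subst_points A \<theta>. p x \<le> M"
    and "homeomorphic_map (subst_space A \<theta>) (subst_space A \<theta>) (speedup p)"
    and "minimal_homeo (subst_space A \<theta>) (speedup p)"
  shows "\<exists>(B :: nat set) \<tau>. substitution B \<tau> \<and> primitive_subst B \<tau> \<and>
           conjugate_systems (subst_space A \<theta>) (speedup p) (subst_space B \<tau>) shift"
proof -
  obtain \<kappa> l r where "positive_subst A (subst_iter \<theta> \<kappa>) l r"
    and points: "subst_points A (subst_iter \<theta> \<kappa>) = subst_points A \<theta>"
    using positive_power[OF assms(1-3)] by blast
  then interpret positive_subst A "subst_iter \<theta> \<kappa>" l r by simp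
  have space: "subst_space A (subst_iter \<theta> \<kappa>) = subst_space A \<theta>"
    by (simp add: subst_space_def points)
  obtain M where M: "\<forall>x\<in>subst_points A \<theta>. p x \<le> M" using assms(6) by blast
  have "aperiodic_subst A (subst_iter \<theta> \<kappa>)" using assms(4) by (simp add: aperiodic_subst_def points)
  from speedup_is_substitution_system[OF this, of p M] show ?thesis
    using assms(5,8) M by (simp add: points space)
qed

end
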